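(* Let $(G,X)$ be a minimal topological dynamical system. Then for every integer $d\ge 1$ the relation $\mathbf{NRP}^{[d]}(X)\subset X\times X$ is a closed $G$-invariant equivalence relation on $X$.
   Context: A topological dynamical system (t.d.s.) $(G,X)$ is a Hausdorff topological group $G$ acting continuously on a compact Hausdorff space $X$; it is minimal if every orbit $Gx$ is dense in $X$. For $d\ge 0$, $X^{[d]}$ is the set of maps $\{0,1\}^d\to X$ with the product topology, and for $x\in X$, $x^{[d]}\in X^{[d]}$ is the constant map with value $x$. For $h\in G$ and $F\subset\{0,1\}^d$, $[h]_F\in G^{[d]}=G^{\{0,1\}^d}$ is given by $[h]_F(\omega)=h$ if $\omega\in F$ and $[h]_F(\omega)=\mathrm{Id}$ otherwise. A hyperface of $\{0,1\}^d$ is a set $\{\omega:\omega_i=a\}$ with $1\le i\le d$, $a\in\{0,1\}$. The Host-Kra cube group $\mathcal{HK}^{[d]}$ is the subgroup of $G^{[d]}$ generated by all $[h]_F$ with $h\in G$ and $F$ a hyperface. It acts coordinatewise on $X^{[d]}$. The set of dynamical cubes is $C_G^{[d]}(X)=\overline{\{g x^{[d]}: g\in\mathcal{HK}^{[d]},\ x\in X\}}\subset X^{[d]}$. For $x,y\in X$, $\llcorner^{[d]}(x,y)\in X^{[d]}$ is the configuration with value $y$ at $\vec 1=(1,\dots,1)$ and value $x$ at all other $\omega\in\{0,1\}^d$. For $d\ge1$, the nilpotent regionally proximal relation of order $d$ is $\mathbf{NRP}^{[d]}(X)=\{(x,y)\in X\times X:\ \llcorner^{[d+1]}(x,y)\in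 C_G^{[d+1]}(X)\}$. $G$-invariance is with respect to the diagonal action on $X\times X$. *)

theory Defs
  imports "HOL-Analysis.Analysis" "HOL-Algebra.Group_Action" "HOL-Algebra.Generated_Groups"
    "HOL-Algebra.Product_Groups"
begin

locale topological_group = group G for G (structure) +
  fixes T :: "'a topology"
  assumes topspace_carrier: "topspace T = carrier G"
    and continuous_mult: "continuous_map (prod_topology T T) T (\<lambda>(g, h). g \<otimes> h)"
    and continuous_inv: "continuous_map T T (\<lambda>g. inv g)"

text \<open>
  Following \<^locale>\<open>group_action\<close>, the bijections \<open>\<phi> g\<close> are extensional, i.e. \<^const>\<open>undefined\<close>
  outside \<^term>\<open>topspace X\<close>; this only normalises the representation of the action.
\<close>

locale topological_dynamical_system =
  topological_group G T + group_action G "topspace X" \<phi>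
  for G (structure) and T :: "'a topology" and X :: "'b topology" and \<phi> :: "'a \<Rightarrow> 'b \<Rightarrow> 'b" +
  assumes Hausdorff_group: "Hausdorff_space T"
    and compact: "compact_space X"
    and Hausdorff: "Hausdorff_space X"
    and continuous_action: "continuous_map (prod_topology T X) X (\<lambda>(g, x). \<phi> g x)"

locale minimal_system = topological_dynamical_system +
  assumes dense_orbit: "x \<in> topspace X \<Longrightarrow> X closure_of orbit G \<phi> x = topspace X"

text \<open>
  The discrete cube \<open>{0,1}\<^sup>d\<close>, coordinates being numbered from \<open>1\<close> to \<open>d\<close>. Elements of
  \<open>X\<^bsup>[d]\<^esup>\<close> are extensional functions on it, the carrier of the product topology
  \<open>product_topology (\<lambda>_. X) (cube d)\<close>; likewise \<open>G\<^bsup>[d]\<^esup>\<close> is \<open>product_group (cube d) (\<lambda>_. G)\<close>.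
\<close>

definition cube :: "nat \<Rightarrow> (nat \<Rightarrow> nat) set" where
  "cube d = (\<Pi>\<^sub>E i\<in>{1..d}. {0, 1})"

definition hyperfaces :: "nat \<Rightarrow> (nat \<Rightarrow> nat) set set" where
  "hyperfaces d = {{\<omega> \<in> cube d. \<omega> i = a} | i a. i \<in> {1..d} \<and> a \<in> {0, 1}}"

definition face_elem ::
  "('a, 'm) monoid_scheme \<Rightarrow> nat \<Rightarrow> 'a \<Rightarrow> (nat \<Rightarrow> nat) set \<Rightarrow> (nat \<Rightarrow> nat) \<Rightarrow> 'a" where
  "face_elem G d h F = (\<lambda>\<omega>\<in>cube d. if \<omega> \<in> F then h else \<one>\<^bsub>G\<^esub>)"

definition host_kra :: "('a, 'm) monoid_scheme \<Rightarrow> nat \<Rightarrow> ((nat \<Rightarrow> nat) \<Rightarrow> 'a) set" where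
  "host_kra G d = generate (product_group (cube d) (\<lambda>_. G))
     {face_elem G d h F | h F. h \<in> carrier G \<and> F \<in> hyperfaces d}"

definition cube_action ::
  "('a \<Rightarrow> 'b \<Rightarrow> 'b) \<Rightarrow> nat \<Rightarrow> ((nat \<Rightarrow> nat) \<Rightarrow> 'a) \<Rightarrow> ((nat \<Rightarrow> nat) \<Rightarrow> 'b) \<Rightarrow> (nat \<Rightarrow> nat) \<Rightarrow> 'b" where
  "cube_action \<phi> d g c = (\<lambda>\<omega>\<in>cube d. \<phi> (g \<omega>) (c \<omega>))"

definition const_cube :: "nat \<Rightarrow> 'b \<Rightarrow> (nat \<Rightarrow> nat) \<Rightarrow> 'b" where
  "const_cube d x = (\<lambda>\<omega>\<in>cube d. x)"

definition dynamical_cubes ::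
  "('a, 'm) monoid_scheme \<Rightarrow> 'b topology \<Rightarrow> ('a \<Rightarrow> 'b \<Rightarrow> 'b) \<Rightarrow> nat \<Rightarrow> ((nat \<Rightarrow> nat) \<Rightarrow> 'b) set" where
  "dynamical_cubes G X \<phi> d = product_topology (\<lambda>_. X) (cube d) closure_of
     {cube_action \<phi> d g (const_cube d x) | g x. g \<in> host_kra G d \<and> x \<in> topspace X}"

definition ones :: "nat \<Rightarrow> nat \<Rightarrow> nat" where
  "ones d = (\<lambda>i\<in>{1..d}. 1)"

definition corner :: "nat \<Rightarrow> 'b \<Rightarrow> 'b \<Rightarrow> (nat \<Rightarrow> nat) \<Rightarrow> 'b" where
  "corner d x y = (\<lambda>\<omega>\<in>cube d. if \<omega> = ones d then y else x)"

definition NRP ::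
  "('a, 'm) monoid_scheme \<Rightarrow> 'b topology \<Rightarrow> ('a \<Rightarrow> 'b \<Rightarrow> 'b) \<Rightarrow> nat \<Rightarrow> ('b \<times> 'b) set" where
  "NRP G X \<phi> d = {(x, y) \<in> topspace X \<times> topspace X.
     corner (d + 1) x y \<in> dynamical_cubes G X \<phi> (d + 1)}"

end

theory Submission
  imports Defs
begin

text \<open>
  Fix \<open>n = d + 1\<close>, let \<open>H\<close> be the Host-Kra cube group and \<open>F\<close> its subgroup fixing the coordinate
  \<open>ones n\<close>. If \<open>u\<close> is a minimal idempotent of the Ellis semigroup of \<open>X\<close>, then the tuple that is the
  identity at \<open>ones n\<close> and \<open>u\<close> elsewhere is a product of limits of face elements, so it lies in the
  Ellis semigroup of \<open>F\<close>, and its minimality can be tested coordinatewise. Hence every point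
  \<open>corner n x y\<close> is \<open>F\<close>-minimal, and likewise every constant point is \<open>H\<close>-minimal. The main step is
  that the \<open>F\<close>-orbit closure of any cube \<open>c\<close> contains the constant with value \<open>c (ones n)\<close>; the
  coordinates are made constant on larger and larger faces through \<open>ones n\<close>. It follows that
  \<open>(x, y)\<close> is in \<open>NRP\<close> iff \<open>corner n x y\<close> lies in the \<open>F\<close>-orbit closure of the constant \<open>y\<close>.
  Since \<open>F\<close> does not move the coordinate \<open>ones n\<close>, the value there may be replaced freely, and
  symmetry and transitivity of \<open>NRP\<close> are read off from \<open>F\<close>-minimality.
\<close>

section \<open>Compact right topological semigroups\<close>

text \<open>Zorn's lemma for reverse inclusion, run on complements. Compactness makes the
  intersection of a chain of nonempty closed sets nonempty, so \<open>Inter\<close> need only cover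
  families whose intersection is nonempty.\<close>

lemma minimal_closed_set:
  assumes "compact_space S" and "\<A> \<noteq> {}"
    and closed: "\<And>A. A \<in> \<A> \<Longrightarrow> closedin S A \<and> A \<noteq> {}"
    and Inter: "\<And>\<C>. \<lbrakk>\<C> \<noteq> {}; \<C> \<subseteq> \<A>; \<Inter>\<C> \<noteq> {}\<rbrakk> \<Longrightarrow> \<Inter>\<C> \<in> \<A>"
  shows "\<exists>M\<in>\<A>. \<forall>A\<in>\<A>. A \<subseteq> M \<longrightarrow> A = M"
proof -
  have "\<exists>N\<in>uminus ` \<A>. \<forall>B\<in>uminus ` \<A>. N \<subseteq> B \<longrightarrow> B = N"
  proof (rule subset_Zorn_nonempty)
    show "uminus ` \<A> \<noteq> {}" using assms(2) by simp
  next
    fix \<D> assume \<D>: "\<D> \<noteq> {}" "subset.chain (uminus ` \<A>) \<D>"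
    define \<C> where "\<C> = uminus ` \<D>"
    have \<C>: "\<C> \<noteq> {}" "\<C> \<subseteq> \<A>"
      using \<D> by (auto simp: \<C>_def subset.chain_def)
    have lin: "A \<subseteq> B \<or> B \<subseteq> A" if "A \<in> \<C>" "B \<in> \<C>" for A B
    proof -
      have "- A \<in> \<D>" "- B \<in> \<D>" using that by (auto simp: \<C>_def)
      then have "- A \<subseteq> - B \<or> - B \<subseteq> - A" using \<D>(2) unfolding subset_chain_def by metis
      then show ?thesis by (simp add: disj_commute)
    qed
    have fin: "\<Inter>\<F> \<in> \<C>" if "finite \<F>" "\<F> \<noteq> {}" "\<F> \<subseteq> \<C>" for \<F>
      using that
    proof (induction \<F> rule: finite_ne_induct)
      case (insert A \<F>)
      then show ?case using lin[of A "\<Inter>\<F>"] by (auto simp: Int_absorb1 Int_absorb2)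
    qed simp
    have "\<Inter>\<C> \<noteq> {}"
    proof -
      have "\<forall>C\<in>\<C>. closedin S C" using \<C> closed by blast
      moreover have "\<Inter>\<F> \<noteq> {}" if "finite \<F>" "\<F> \<subseteq> \<C>" for \<F>
        using fin[OF that(1) _ that(2)] closed \<C>(2) by (cases "\<F> = {}") auto
      ultimately show ?thesis
        using assms(1)[unfolded compact_space_fip, THEN spec, of \<C>] by (simp del: Inter_iff)
    qed
    then have "\<Inter>\<C> \<in> \<A>" using Inter \<C> by blast
    moreover have "\<Union>\<D> = - \<Inter>\<C>" by (auto simp: \<C>_def)
    ultimately show "\<Union>\<D> \<in> uminus ` \<A>" by blast
  qed
  then obtain M where "M \<in> \<A>" "\<And>A. A \<in> \<A> \<Longrightarrow> - M \<subseteq> - A \<Longrightarrow> - A = - M"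
    by auto
  then show ?thesis by (metis Compl_anti_mono double_complement)
qed

text \<open>A continuous map from a compact space to a Hausdorff space is closed. The equality,
  rather than one inclusion, is what lets limit points be lifted along \<open>f\<close>.\<close>

lemma closure_of_continuous_image:
  assumes "continuous_map S S' f" "compact_space S" "Hausdorff_space S'" "A \<subseteq> topspace S"
  shows "f ` (S closure_of A) = S' closure_of (f ` A)"
  using continuous_map_image_closure_subset[OF assms(1), of A]
    continuous_imp_closed_map[OF assms(1-3)] assms(4)
  unfolding closed_map_closure_of_image by blast

lemma closedin_continuous_image:
  assumes "continuous_map S S' f" "compact_space S" "Hausdorff_space S'" "closedin S A"
  shows "closedin S' (f ` A)"
  using continuous_imp_closed_map[OF assms(1-3)] assms(4) by (simp add: closed_map_def)

text \<open>Continuity is required in the left factor only. This suits composition of arbitrary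
  self-maps in the pointwise topology: evaluating a composite of \<open>p\<close> after
  \<open>q\<close> at \<open>x\<close> evaluates \<open>p\<close> at the fixed point
  \<open>q x\<close>.\<close>

locale compact_right_semigroup =
  fixes S :: "'s topology" and mul :: "'s \<Rightarrow> 's \<Rightarrow> 's" (infixl "\<cdot>" 70)
  assumes compact_S: "compact_space S" and Hausdorff_S: "Hausdorff_space S"
    and mul_closed: "\<lbrakk>p \<in> topspace S; q \<in> topspace S\<rbrakk> \<Longrightarrow> p \<cdot> q \<in> topspace S"
    and mul_assoc: "\<lbrakk>p \<in> topspace S; q \<in> topspace S; r \<in> topspace S\<rbrakk> \<Longrightarrow> p \<cdot> q \<cdot> r = p \<cdot> (q \<cdot> r)"
    and continuous_right_mul: "q \<in> topspace S \<Longrightarrow> continuous_map S S (\<lambda>p. p \<cdot> q)"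
begin

lemma closedin_right_mul_image:
  "\<lbrakk>closedin S A; q \<in> topspace S\<rbrakk> \<Longrightarrow> closedin S ((\<lambda>p. p \<cdot> q) ` A)"
  by (rule closedin_continuous_image[OF continuous_right_mul compact_S Hausdorff_S])

lemma closedin_right_mul_preimage:
  "\<lbrakk>closedin S A; closedin S B; q \<in> topspace S\<rbrakk> \<Longrightarrow> closedin S {p \<in> A. p \<cdot> q \<in> B}"
  by (rule closedin_continuous_map_preimage_gen[OF continuous_right_mul])

text \<open>Limits are taken one factor at a time: first on the right, where left multiplication by
  elements of \<open>A\<close> is continuous, then on the left, where multiplication by any fixed
  \<open>q\<close> is.\<close>

lemma closure_of_semigroup:
  assumes "A \<subseteq> topspace S" and left: "\<And>a. a \<in> A \<Longrightarrow> continuous_map S S (\<lambda>p. a \<cdot> p)"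
    and mult: "\<And>a b. a \<in> A \<Longrightarrow> b \<in> A \<Longrightarrow> a \<cdot> b \<in> A"
    and p: "p \<in> S closure_of A" and q: "q \<in> S closure_of A"
  shows "p \<cdot> q \<in> S closure_of A"
proof -
  have *: "a \<cdot> q \<in> S closure_of A" if "a \<in> A" for a
  proof -
    have "(\<lambda>p. a \<cdot> p) ` A \<subseteq> A" using mult that by blast
    then show ?thesis
      using continuous_map_image_closure_subset[OF left[OF that], of A] q closure_of_mono by blast
  qed
  have "q \<in> topspace S" using q by (meson closure_of_subset_topspace subsetD)
  then have "closedin S {p \<in> topspace S. p \<cdot> q \<in> S closure_of A}"
    by (intro closedin_right_mul_preimage) auto
  then have "S closure_of A \<subseteq> {p \<in> topspace S. p \<cdot> q \<in> S closure_of A}"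
    using * assms(1) by (intro closure_of_minimal) auto
  then show ?thesis using p by blast
qed

text \<open>The Ellis-Numakura lemma. In a minimal closed subsemigroup \<open>M\<close> with
  \<open>e\<close> in \<open>M\<close>, minimality gives first that \<open>M\<close> multiplied by
  \<open>e\<close> on the right is \<open>M\<close>, so some \<open>f\<close> satisfies
  \<open>f \<cdot> e = e\<close>; then the solutions of this equation form a closed subsemigroup,
  hence all of \<open>M\<close>, and \<open>e\<close> itself is a solution.\<close>

lemma exists_idempotent:
  assumes "closedin S A" "A \<noteq> {}" "\<And>p q. p \<in> A \<Longrightarrow> q \<in> A \<Longrightarrow> p \<cdot> q \<in> A"
  shows "\<exists>e\<in>A. e \<cdot> e = e"
proof -
  define \<A> where "\<A> = {B. closedin S B \<and> B \<noteq> {} \<and> B \<subseteq> A \<and> (\<forall>p\<in>B. \<forall>q\<in>B. p \<cdot> q \<in> B)}"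
  have "\<exists>M\<in>\<A>. \<forall>B\<in>\<A>. B \<subseteq> M \<longrightarrow> B = M"
  proof (rule minimal_closed_set[OF compact_S])
    show "\<A> \<noteq> {}" using assms by (auto simp: \<A>_def)
    show "\<Inter>\<C> \<in> \<A>" if "\<C> \<noteq> {}" "\<C> \<subseteq> \<A>" "\<Inter>\<C> \<noteq> {}" for \<C>
    proof -
      have "closedin S (\<Inter>\<C>)" using that by (intro closedin_Inter) (auto simp: \<A>_def)
      then show ?thesis using that unfolding \<A>_def by blast
    qed
  qed (auto simp: \<A>_def)
  then obtain M where M\<A>: "M \<in> \<A>" and M_min: "\<And>B. B \<in> \<A> \<Longrightarrow> B \<subseteq> M \<Longrightarrow> B = M"
    by blast
  have M: "closedin S M" "M \<noteq> {}" "M \<subseteq> A" "\<And>p q. p \<in> M \<Longrightarrow> q \<in> M \<Longrightarrow> p \<cdot> q \<in> M"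
    using M\<A> by (auto simp: \<A>_def)
  have min: "B = M" if "closedin S B" "B \<noteq> {}" "B \<subseteq> M" "\<And>p q. p \<in> B \<Longrightarrow> q \<in> B \<Longrightarrow> p \<cdot> q \<in> B" for B
    using that M(3) by (intro M_min) (auto simp: \<A>_def)
  obtain e where e: "e \<in> M" using M by blast
  have MS: "M \<subseteq> topspace S" using M(1) closedin_subset by blast
  have "(\<lambda>p. p \<cdot> e) ` M = M"
  proof (rule min)
    show "closedin S ((\<lambda>p. p \<cdot> e) ` M)" using closedin_right_mul_image M e MS by blast
    show "p \<cdot> q \<in> (\<lambda>p. p \<cdot> e) ` M" if pq: "p \<in> (\<lambda>p. p \<cdot> e) ` M" "q \<in> (\<lambda>p. p \<cdot> e) ` M" for p q
    proof -
      obtain q' where q': "q' \<in> M" "q = q' \<cdot> e" using pq by blast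
      have "p \<in> M" using pq M e by blast
      then show ?thesis using q' M(4) MS e mul_assoc[of p q' e] by (metis image_iff subsetD)
    qed
  qed (use M e in auto)
  then obtain f where "f \<in> M" "f \<cdot> e = e" using e by (metis image_iff)
  have "{p \<in> M. p \<cdot> e \<in> {e}} = M"
  proof (rule min)
    show "closedin S {p \<in> M. p \<cdot> e \<in> {e}}"
      using e MS M(1) Hausdorff_S
      by (intro closedin_right_mul_preimage) (auto intro: closedin_Hausdorff_singleton)
    show "p \<cdot> q \<in> {p \<in> M. p \<cdot> e \<in> {e}}"
      if "p \<in> {p \<in> M. p \<cdot> e \<in> {e}}" "q \<in> {p \<in> M. p \<cdot> e \<in> {e}}" for p q
      using that M(4) MS e mul_assoc[of p q e] by auto
  qed (use \<open>f \<in> M\<close> \<open>f \<cdot> e = e\<close> in auto)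
  then show ?thesis using e M(3) by blast
qed

text \<open>For \<open>w\<close> in a minimal closed left ideal \<open>L\<close>, the products of
  elements of \<open>L\<close> with \<open>w\<close> again form a closed left ideal inside
  \<open>L\<close>, hence exhaust it. So each \<open>p\<close> in \<open>L\<close> is some
  \<open>q \<cdot> w\<close>, and an idempotent \<open>w\<close> is a right identity on
  \<open>L\<close>.\<close>

lemma exists_minimal_left_ideal:
  assumes "closedin S E" "E \<noteq> {}" and E: "\<And>p q. p \<in> E \<Longrightarrow> q \<in> E \<Longrightarrow> p \<cdot> q \<in> E"
  obtains L where "closedin S L" "L \<noteq> {}" "L \<subseteq> E" "\<And>p q. p \<in> E \<Longrightarrow> q \<in> L \<Longrightarrow> p \<cdot> q \<in> L"
    "\<And>p w. \<lbrakk>p \<in> L; w \<in> L; w \<cdot> w = w\<rbrakk> \<Longrightarrow> p \<cdot> w = p"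
proof -
  define \<A> where "\<A> = {B. closedin S B \<and> B \<noteq> {} \<and> B \<subseteq> E \<and> (\<forall>p\<in>E. \<forall>q\<in>B. p \<cdot> q \<in> B)}"
  have "\<exists>M\<in>\<A>. \<forall>B\<in>\<A>. B \<subseteq> M \<longrightarrow> B = M"
  proof (rule minimal_closed_set[OF compact_S])
    show "\<A> \<noteq> {}" using assms by (auto simp: \<A>_def)
    show "\<Inter>\<C> \<in> \<A>" if "\<C> \<noteq> {}" "\<C> \<subseteq> \<A>" "\<Inter>\<C> \<noteq> {}" for \<C>
    proof -
      have "closedin S (\<Inter>\<C>)" using that by (intro closedin_Inter) (auto simp: \<A>_def)
      then show ?thesis using that unfolding \<A>_def by blast
    qed
  qed (auto simp: \<A>_def)
  then obtain L where L\<A>: "L \<in> \<A>" and L_min: "\<And>B. B \<in> \<A> \<Longrightarrow> B \<subseteq> L \<Longrightarrow> B = L"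
    by blast
  have L: "closedin S L" "L \<noteq> {}" "L \<subseteq> E" "\<And>p q. p \<in> E \<Longrightarrow> q \<in> L \<Longrightarrow> p \<cdot> q \<in> L"
    using L\<A> by (auto simp: \<A>_def)
  have min: "B = L" if "closedin S B" "B \<noteq> {}" "B \<subseteq> L" "\<And>p q. p \<in> E \<Longrightarrow> q \<in> B \<Longrightarrow> p \<cdot> q \<in> B" for B
    using that L(3) by (intro L_min) (auto simp: \<A>_def)
  have ES: "E \<subseteq> topspace S" using assms(1) closedin_subset by blast
  have "p \<cdot> w = p" if pw: "p \<in> L" "w \<in> L" "w \<cdot> w = w" for p w
  proof -
    have "(\<lambda>q. q \<cdot> w) ` L = L"
    proof (rule min)
      show "closedin S ((\<lambda>q. q \<cdot> w) ` L)" using closedin_right_mul_image L ES pw by blast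
      show "r \<cdot> q \<in> (\<lambda>q. q \<cdot> w) ` L" if rq: "r \<in> E" "q \<in> (\<lambda>q. q \<cdot> w) ` L" for r q
      proof -
        obtain q' where q': "q' \<in> L" "q = q' \<cdot> w" using rq by blast
        then show ?thesis using rq L(3,4) ES pw mul_assoc[of r q' w] by (metis image_iff subsetD)
      qed
    qed (use L pw in auto)
    then obtain q where "q \<in> L" "p = q \<cdot> w" using pw(1) by (metis image_iff)
    then show ?thesis using mul_assoc[of q w w] pw L(3) ES by (metis subsetD)
  qed
  with L that show thesis by blast
qed

end

lemma compact_right_semigroup_maps:
  assumes "compact_space X" "Hausdorff_space X"
  shows "compact_right_semigroup (product_topology (\<lambda>_. X) (topspace X)) (compose (topspace X))"
proof
  show "compact_space (product_topology (\<lambda>_. X) (topspace X))"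
    using assms by (simp add: compact_space_product_topology)
  show "Hausdorff_space (product_topology (\<lambda>_. X) (topspace X))"
    using assms by (simp add: Hausdorff_space_product_topology)
  show "continuous_map (product_topology (\<lambda>_. X) (topspace X)) (product_topology (\<lambda>_. X) (topspace X))
      (\<lambda>p. compose (topspace X) p q)"
    if "q \<in> topspace (product_topology (\<lambda>_. X) (topspace X))" for q
    using that unfolding compose_def
    by (auto simp: continuous_map_componentwise intro!: continuous_map_product_projection)
qed (auto simp: compose_def PiE_def extensional_def Pi_iff fun_eq_iff)

lemma compact_right_semigroup_product:
  assumes "compact_right_semigroup S mul"
  shows "compact_right_semigroup (product_topology (\<lambda>_. S) I) (\<lambda>p q. \<lambda>i\<in>I. mul (p i) (q i))"
proof -
  interpret compact_right_semigroup S mul by fact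
  show ?thesis
  proof
    show "compact_space (product_topology (\<lambda>_. S) I)"
      using compact_S by (simp add: compact_space_product_topology)
    show "Hausdorff_space (product_topology (\<lambda>_. S) I)"
      using Hausdorff_S by (simp add: Hausdorff_space_product_topology)
    show "continuous_map (product_topology (\<lambda>_. S) I) (product_topology (\<lambda>_. S) I)
        (\<lambda>p. \<lambda>i\<in>I. mul (p i) (q i))" if "q \<in> topspace (product_topology (\<lambda>_. S) I)" for q
      unfolding continuous_map_componentwise
    proof (intro conjI ballI)
      fix i assume i: "i \<in> I"
      then have "continuous_map (product_topology (\<lambda>_. S) I) S ((\<lambda>p. mul p (q i)) \<circ> (\<lambda>p. p i))"
        using that
        by (intro continuous_map_compose[where X' = S] continuous_map_product_projection
            continuous_right_mul) auto
      then show "continuous_map (product_topology (\<lambda>_. S) I) S (\<lambda>p. (\<lambda>i\<in>I. mul (p i) (q i)) i)"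
        using i by (simp add: o_def)
    qed auto
  qed (auto simp: mul_closed mul_assoc PiE_iff)
qed

section \<open>Ellis semigroups and minimal points\<close>

context topological_dynamical_system
begin

abbreviation "maps_top \<equiv> product_topology (\<lambda>_. X) (topspace X)"

definition ellis :: "('b \<Rightarrow> 'b) set" where
  "ellis = maps_top closure_of (\<phi> ` carrier G)"

text \<open>The enveloping semigroup of \<Gamma> acting on the power of \<open>X\<close>, but stored
  as tuples of self-maps of \<open>X\<close>. Identities between its elements can thus be tested in
  each coordinate.\<close>

definition env :: "'i set \<Rightarrow> ('i \<Rightarrow> 'a) set \<Rightarrow> ('i \<Rightarrow> 'b \<Rightarrow> 'b) set" where
  "env I \<Gamma> = product_topology (\<lambda>_. maps_top) I closure_of ((\<lambda>\<gamma>. \<lambda>i\<in>I. \<phi> (\<gamma> i)) ` \<Gamma>)"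

definition pointwise :: "'i set \<Rightarrow> ('i \<Rightarrow> 'b \<Rightarrow> 'b) \<Rightarrow> ('i \<Rightarrow> 'b) \<Rightarrow> 'i \<Rightarrow> 'b" where
  "pointwise I p c = (\<lambda>i\<in>I. p i (c i))"

definition orbit_closure :: "'i set \<Rightarrow> ('i \<Rightarrow> 'a) set \<Rightarrow> ('i \<Rightarrow> 'b) \<Rightarrow> ('i \<Rightarrow> 'b) set" where
  "orbit_closure I \<Gamma> c =
    product_topology (\<lambda>_. X) I closure_of ((\<lambda>\<gamma>. pointwise I (\<lambda>i. \<phi> (\<gamma> i)) c) ` \<Gamma>)"

interpretation maps: compact_right_semigroup maps_top "compose (topspace X)"
  by (rule compact_right_semigroup_maps[OF compact Hausdorff])

lemma action_in_topspace: "\<lbrakk>g \<in> carrier G; x \<in> topspace X\<rbrakk> \<Longrightarrow> \<phi> g x \<in> topspace X"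
  using element_image by blast

lemma continuous_map_action: "g \<in> carrier G \<Longrightarrow> continuous_map X X (\<phi> g)"
  using continuous_map_compose[OF _ continuous_action, of X "\<lambda>x. (g, x)"]
  by (simp add: o_def continuous_map_paired topspace_carrier)

lemma action_in_maps: "g \<in> carrier G \<Longrightarrow> \<phi> g \<in> topspace maps_top"
  using bij_prop0[of g] action_in_topspace[of g] by (auto simp: Bij_def PiE_iff)

lemma compose_action:
  "\<lbrakk>g \<in> carrier G; h \<in> carrier G\<rbrakk> \<Longrightarrow> compose (topspace X) (\<phi> g) (\<phi> h) = \<phi> (g \<otimes> h)"
  using action_in_maps[of "g \<otimes> h"] composition_rule[of _ g h]
  by (auto simp: fun_eq_iff compose_def PiE_iff extensional_def)

lemma action_one: "x \<in> topspace X \<Longrightarrow> \<phi> \<one> x = x"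
  using id_eq_one by (metis restrict_apply')

lemma compose_action_one: "p \<in> topspace maps_top \<Longrightarrow> compose (topspace X) (\<phi> \<one>) p = p"
  by (auto simp: fun_eq_iff compose_def PiE_iff extensional_def action_one)

lemma ellis_subset: "ellis \<subseteq> topspace maps_top"
  unfolding ellis_def by (rule closure_of_subset_topspace)

lemma action_in_ellis: "g \<in> carrier G \<Longrightarrow> \<phi> g \<in> ellis"
  unfolding ellis_def using action_in_maps by (intro subsetD[OF closure_of_subset]) auto

text \<open>Left composition with a discontinuous map may be discontinuous; here continuity of
  \<open>\<phi> g\<close> on \<open>X\<close> is what makes it work. It supplies the left continuity
  required by \<open>closure_of_semigroup\<close>.\<close>

lemma continuous_map_compose_action:
  assumes "g \<in> carrier G"
  shows "continuous_map maps_top maps_top (compose (topspace X) (\<phi> g))"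
  unfolding continuous_map_componentwise
proof (intro conjI ballI)
  fix x assume x: "x \<in> topspace X"
  have "continuous_map maps_top X (\<phi> g \<circ> (\<lambda>p. p x))"
    using x by (intro continuous_map_compose[where X' = X] continuous_map_product_projection
        continuous_map_action[OF assms])
  then show "continuous_map maps_top X (\<lambda>p. compose (topspace X) (\<phi> g) p x)"
    using x by (simp add: o_def compose_def)
qed (auto simp: compose_def)

lemma ellis_semigroup: "\<lbrakk>p \<in> ellis; q \<in> ellis\<rbrakk> \<Longrightarrow> compose (topspace X) p q \<in> ellis"
  unfolding ellis_def
proof (rule maps.closure_of_semigroup)
  show "\<phi> ` carrier G \<subseteq> topspace maps_top" using action_in_maps by blast
qed (auto simp: compose_action intro!: continuous_map_compose_action simp del: topspace_product_topology)

lemma continuous_map_eval: "x \<in> topspace X \<Longrightarrow> continuous_map maps_top X (\<lambda>p. p x)"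
  by (rule continuous_map_product_projection)

end

text \<open>
  The last property says that \<open>u\<close> lies in a minimal left ideal; this form survives the passage to
  products, where it is applied in each coordinate separately.
\<close>
lemma (in minimal_system) exists_minimal_idempotent:
  assumes "y \<in> topspace X"
  obtains u where "u \<in> ellis" "compose (topspace X) u u = u" "u y = y"
    "\<And>r w. \<lbrakk>r \<in> ellis; w = compose (topspace X) r u; compose (topspace X) w w = w\<rbrakk>
      \<Longrightarrow> compose (topspace X) u w = u"
proof -
  interpret maps: compact_right_semigroup maps_top "compose (topspace X)"
    by (rule compact_right_semigroup_maps[OF compact Hausdorff])
  obtain L where L: "closedin maps_top L" "L \<noteq> {}" "L \<subseteq> ellis"
      "\<And>p q. p \<in> ellis \<Longrightarrow> q \<in> L \<Longrightarrow> compose (topspace X) p q \<in> L"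
    and idem: "\<And>p w. \<lbrakk>p \<in> L; w \<in> L; compose (topspace X) w w = w\<rbrakk> \<Longrightarrow> compose (topspace X) p w = p"
  proof (rule maps.exists_minimal_left_ideal)
    show "closedin maps_top ellis" by (simp add: ellis_def)
    show "ellis \<noteq> {}" using action_in_ellis[OF one_closed] by blast
  qed (auto intro: ellis_semigroup)
  have LX: "L \<subseteq> topspace maps_top" using L(3) ellis_subset by blast
  have Ly: "closedin X ((\<lambda>p. p y) ` L)"
    using closedin_continuous_image[OF continuous_map_eval[OF assms] maps.compact_S Hausdorff L(1)] .
  obtain q where q: "q \<in> L" using L(2) by blast
  then have qy: "q y \<in> topspace X" using LX assms by auto
  \<comment> \<open>The values at \<open>y\<close> of elements of \<open>L\<close> form a closed set
    containing a whole orbit. Minimality of the system makes it all of \<open>X\<close>, so some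
    element of \<open>L\<close> fixes \<open>y\<close>.\<close>
  have "orbit G \<phi> (q y) \<subseteq> (\<lambda>p. p y) ` L"
  proof
    fix x assume "x \<in> orbit G \<phi> (q y)"
    then obtain g where g: "g \<in> carrier G" "x = \<phi> g (q y)" by (auto simp: orbit_def)
    then have "x = compose (topspace X) (\<phi> g) q y" using assms by (simp add: compose_def)
    then show "x \<in> (\<lambda>p. p y) ` L" using L(4)[OF action_in_ellis[OF g(1)] q] by blast
  qed
  then have "topspace X \<subseteq> (\<lambda>p. p y) ` L"
    using closure_of_minimal[OF _ Ly] dense_orbit[OF qy] by blast
  then obtain p where p: "p \<in> L" "p y = y" using assms by force
  \<comment> \<open>The elements of \<open>L\<close> fixing \<open>y\<close> form a nonempty closed
    subsemigroup, so one of them is idempotent.\<close>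
  have "\<exists>u\<in>{p \<in> L. p y \<in> {y}}. compose (topspace X) u u = u"
  proof (rule maps.exists_idempotent)
    show "closedin maps_top {p \<in> L. p y \<in> {y}}"
      using L(1) assms Hausdorff
      by (intro closedin_continuous_map_preimage_gen[OF continuous_map_eval])
        (auto intro: closedin_Hausdorff_singleton)
    show "compose (topspace X) p q \<in> {p \<in> L. p y \<in> {y}}"
      if "p \<in> {p \<in> L. p y \<in> {y}}" "q \<in> {p \<in> L. p y \<in> {y}}" for p q
      using that L(3,4) assms by (auto simp: compose_def)
  qed (use p in auto)
  then obtain u where u: "u \<in> L" "u y = y" "compose (topspace X) u u = u" by blast
  show thesis
  proof
    show "compose (topspace X) u w = u"
      if "r \<in> ellis" "w = compose (topspace X) r u" "compose (topspace X) w w = w" for r w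
      using idem[of u w] L(4)[of r u] that u by blast
  qed (use u L in auto)
qed

context topological_dynamical_system
begin

lemma compact_right_semigroup_env:
  "compact_right_semigroup (product_topology (\<lambda>_. maps_top) I)
     (\<lambda>p q. \<lambda>i\<in>I. compose (topspace X) (p i) (q i))"
  by (intro compact_right_semigroup_product compact_right_semigroup_maps compact Hausdorff)

context
  fixes I :: "'i set" and \<Gamma> :: "('i \<Rightarrow> 'a) set"
  assumes \<Gamma>: "subgroup \<Gamma> (product_group I (\<lambda>_. G))"
begin

interpretation P: compact_right_semigroup "product_topology (\<lambda>_. maps_top) I"
  "\<lambda>p q. \<lambda>i\<in>I. compose (topspace X) (p i) (q i)"
  by (rule compact_right_semigroup_env)

lemma coordinate_closed: "\<lbrakk>\<gamma> \<in> \<Gamma>; i \<in> I\<rbrakk> \<Longrightarrow> \<gamma> i \<in> carrier G"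
  using subgroup.subset[OF \<Gamma>] by auto

lemma coordinatewise_mult_closed: "\<lbrakk>\<gamma> \<in> \<Gamma>; \<delta> \<in> \<Gamma>\<rbrakk> \<Longrightarrow> (\<lambda>i\<in>I. \<gamma> i \<otimes> \<delta> i) \<in> \<Gamma>"
  using subgroup.m_closed[OF \<Gamma>, of \<gamma> \<delta>] by simp

lemma coordinatewise_one_closed: "(\<lambda>i\<in>I. \<one>) \<in> \<Gamma>"
  using subgroup.one_closed[OF \<Gamma>] by simp

lemma action_image_subset:
  "(\<lambda>\<gamma>. \<lambda>i\<in>I. \<phi> (\<gamma> i)) ` \<Gamma> \<subseteq> topspace (product_topology (\<lambda>_. maps_top) I)"
  using action_in_maps coordinate_closed
  by (auto simp: PiE_iff simp del: topspace_product_topology) (auto simp: PiE_iff)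

lemma action_in_env: "\<gamma> \<in> \<Gamma> \<Longrightarrow> (\<lambda>i\<in>I. \<phi> (\<gamma> i)) \<in> env I \<Gamma>"
  unfolding env_def using action_image_subset by (intro subsetD[OF closure_of_subset]) auto

lemma env_subset: "env I \<Gamma> \<subseteq> topspace (product_topology (\<lambda>_. maps_top) I)"
  unfolding env_def by (rule closure_of_subset_topspace)

lemma env_semigroup:
  assumes "p \<in> env I \<Gamma>" "q \<in> env I \<Gamma>"
  shows "(\<lambda>i\<in>I. compose (topspace X) (p i) (q i)) \<in> env I \<Gamma>"
  using assms unfolding env_def
proof (rule P.closure_of_semigroup[OF action_image_subset, rotated 2])
  fix a assume "a \<in> (\<lambda>\<gamma>. \<lambda>i\<in>I. \<phi> (\<gamma> i)) ` \<Gamma>"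
  then obtain \<gamma> where \<gamma>: "\<gamma> \<in> \<Gamma>" "a = (\<lambda>i\<in>I. \<phi> (\<gamma> i))" by blast
  show "continuous_map (product_topology (\<lambda>_. maps_top) I) (product_topology (\<lambda>_. maps_top) I)
      (\<lambda>p. \<lambda>i\<in>I. compose (topspace X) (a i) (p i))"
    unfolding continuous_map_componentwise[where I = I]
  proof (intro conjI ballI)
    fix i assume i: "i \<in> I"
    have "continuous_map (product_topology (\<lambda>_. maps_top) I) maps_top
        (compose (topspace X) (\<phi> (\<gamma> i)) \<circ> (\<lambda>p. p i))"
      using i \<gamma> coordinate_closed by (intro continuous_map_compose[where X' = maps_top]
          continuous_map_product_projection continuous_map_compose_action)
    then show "continuous_map (product_topology (\<lambda>_. maps_top) I) maps_top
        (\<lambda>p. (\<lambda>i\<in>I. compose (topspace X) (a i) (p i)) i)"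
      using i \<gamma> by (simp add: o_def)
  qed auto
next
  fix a b assume "a \<in> (\<lambda>\<gamma>. \<lambda>i\<in>I. \<phi> (\<gamma> i)) ` \<Gamma>" "b \<in> (\<lambda>\<gamma>. \<lambda>i\<in>I. \<phi> (\<gamma> i)) ` \<Gamma>"
  then obtain \<gamma> \<delta> where "\<gamma> \<in> \<Gamma>" "a = (\<lambda>i\<in>I. \<phi> (\<gamma> i))" "\<delta> \<in> \<Gamma>" "b = (\<lambda>i\<in>I. \<phi> (\<delta> i))" by blast
  then have "(\<lambda>i\<in>I. compose (topspace X) (a i) (b i)) = (\<lambda>i\<in>I. \<phi> ((\<lambda>i\<in>I. \<gamma> i \<otimes> \<delta> i) i))"
    by (auto intro!: restrict_ext simp: compose_action coordinate_closed)
  then show "(\<lambda>i\<in>I. compose (topspace X) (a i) (b i)) \<in> (\<lambda>\<gamma>. \<lambda>i\<in>I. \<phi> (\<gamma> i)) ` \<Gamma>"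
    using coordinatewise_mult_closed \<open>\<gamma> \<in> \<Gamma>\<close> \<open>\<delta> \<in> \<Gamma>\<close> by blast
qed

lemma env_coordinate_in_ellis:
  assumes "p \<in> env I \<Gamma>" "i \<in> I"
  shows "p i \<in> ellis"
proof -
  have "continuous_map (product_topology (\<lambda>_. maps_top) I) maps_top (\<lambda>p. p i)"
    by (rule continuous_map_product_projection[OF assms(2)])
  from continuous_map_image_closure_subset[OF this, of "(\<lambda>\<gamma>. \<lambda>i\<in>I. \<phi> (\<gamma> i)) ` \<Gamma>"]
  have "p i \<in> maps_top closure_of ((\<lambda>p. p i) ` (\<lambda>\<gamma>. \<lambda>i\<in>I. \<phi> (\<gamma> i)) ` \<Gamma>)"
    using assms(1) unfolding env_def by blast
  moreover have "(\<lambda>p. p i) ` (\<lambda>\<gamma>. \<lambda>i\<in>I. \<phi> (\<gamma> i)) ` \<Gamma> \<subseteq> \<phi> ` carrier G"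
    using assms(2) coordinate_closed by auto
  ultimately show ?thesis unfolding ellis_def using closure_of_mono by blast
qed

text \<open>Being the identity in coordinate \<open>i\<close> is a closed condition, so it passes
  from \<Gamma> to its enveloping semigroup.\<close>

lemma env_coordinate_trivial:
  assumes "p \<in> env I \<Gamma>" "i \<in> I" and triv: "\<And>\<gamma>. \<gamma> \<in> \<Gamma> \<Longrightarrow> \<gamma> i = \<one>"
  shows "p i = \<phi> \<one>"
proof (rule forall_in_closure_of_eq[OF assms(1)[unfolded env_def]])
  show "Hausdorff_space maps_top" using Hausdorff by (simp add: Hausdorff_space_product_topology)
  show "continuous_map (product_topology (\<lambda>_. maps_top) I) maps_top (\<lambda>p. p i)"
    by (rule continuous_map_product_projection[OF assms(2)])
  show "continuous_map (product_topology (\<lambda>_. maps_top) I) maps_top (\<lambda>p. \<phi> \<one>)"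
    using action_in_maps[OF one_closed] by simp
qed (use assms(2) triv in auto)

lemma pointwise_in_topspace:
  assumes "\<And>i. i \<in> I \<Longrightarrow> p i \<in> topspace maps_top" "c \<in> topspace (product_topology (\<lambda>_. X) I)"
  shows "pointwise I p c \<in> topspace (product_topology (\<lambda>_. X) I)"
  using assms by (auto simp: pointwise_def PiE_iff)

text \<open>Evaluation at \<open>c\<close> is continuous on a compact space, so it carries closures
  onto closures. Every limit point of the orbit is thereby an actual image of \<open>c\<close> under
  an element of \<open>env I \<Gamma>\<close>.\<close>

lemma orbit_closure_eq:
  assumes c: "c \<in> topspace (product_topology (\<lambda>_. X) I)"
  shows "orbit_closure I \<Gamma> c = (\<lambda>p. pointwise I p c) ` env I \<Gamma>"
proof -
  have "continuous_map (product_topology (\<lambda>_. maps_top) I) (product_topology (\<lambda>_. X) I)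
      (\<lambda>p. pointwise I p c)"
    unfolding continuous_map_componentwise
  proof (intro conjI ballI)
    fix i assume i: "i \<in> I"
    have "continuous_map (product_topology (\<lambda>_. maps_top) I) X ((\<lambda>p. p (c i)) \<circ> (\<lambda>p. p i))"
      using i c by (intro continuous_map_compose[where X' = maps_top]
          continuous_map_product_projection continuous_map_eval) auto
    then show "continuous_map (product_topology (\<lambda>_. maps_top) I) X (\<lambda>p. pointwise I p c i)"
      using i by (simp add: o_def pointwise_def)
  qed (auto simp: pointwise_def)
  from closure_of_continuous_image[OF this P.compact_S _ action_image_subset]
  have "(\<lambda>p. pointwise I p c) ` env I \<Gamma> = product_topology (\<lambda>_. X) I closure_of
      (\<lambda>p. pointwise I p c) ` (\<lambda>\<gamma>. \<lambda>i\<in>I. \<phi> (\<gamma> i)) ` \<Gamma>"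
    using Hausdorff by (simp add: Hausdorff_space_product_topology env_def)
  also have "(\<lambda>p. pointwise I p c) ` (\<lambda>\<gamma>. \<lambda>i\<in>I. \<phi> (\<gamma> i)) ` \<Gamma> =
      (\<lambda>\<gamma>. pointwise I (\<lambda>i. \<phi> (\<gamma> i)) c) ` \<Gamma>"
    unfolding image_image by (intro image_cong) (auto simp: pointwise_def fun_eq_iff)
  finally show ?thesis by (simp add: orbit_closure_def)
qed

lemma pointwise_compose:
  assumes "c \<in> topspace (product_topology (\<lambda>_. X) I)"
  shows "pointwise I (\<lambda>i\<in>I. compose (topspace X) (p i) (q i)) c = pointwise I p (pointwise I q c)"
  using assms by (auto simp: pointwise_def compose_def fun_eq_iff PiE_iff)

end

end

text \<open>Minimality of \<open>c\<close> under \<Gamma>. The coordinates outside \<open>J\<close>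
  are not moved, and on \<open>J\<close> the point has the single value \<open>y\<close>, so one
  minimal idempotent \<open>u\<close> fixing \<open>y\<close> serves all moved coordinates. The
  tuple \<open>U\<close> built from it fixes \<open>c\<close> and inherits the absorption property
  of \<open>u\<close>.\<close>

lemma (in minimal_system) mem_orbit_closure_sym:
  assumes \<Gamma>: "subgroup \<Gamma> (product_group I (\<lambda>_. G))"
    and triv: "\<And>\<gamma> i. \<lbrakk>\<gamma> \<in> \<Gamma>; i \<in> I - J\<rbrakk> \<Longrightarrow> \<gamma> i = \<one>"
    and idem: "\<And>u. \<lbrakk>u \<in> ellis; compose (topspace X) u u = u\<rbrakk>
      \<Longrightarrow> (\<lambda>i\<in>I. if i \<in> J then u else \<phi> \<one>) \<in> env I \<Gamma>"
    and c: "c \<in> topspace (product_topology (\<lambda>_. X) I)"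
    and y: "y \<in> topspace X" "\<And>i. i \<in> I \<inter> J \<Longrightarrow> c i = y"
    and z: "z \<in> orbit_closure I \<Gamma> c"
  shows "c \<in> orbit_closure I \<Gamma> z"
proof -
  interpret P: compact_right_semigroup "product_topology (\<lambda>_. maps_top) I"
    "\<lambda>p q. \<lambda>i\<in>I. compose (topspace X) (p i) (q i)"
    by (rule compact_right_semigroup_env)
  obtain u where u: "u \<in> ellis" "compose (topspace X) u u = u" "u y = y"
    and u_absorb: "\<And>r w. \<lbrakk>r \<in> ellis; w = compose (topspace X) r u; compose (topspace X) w w = w\<rbrakk>
      \<Longrightarrow> compose (topspace X) u w = u"
    by (rule exists_minimal_idempotent[OF y(1)]) blast
  define mul where "mul p q = (\<lambda>i\<in>I. compose (topspace X) (p i) (q i))" for p q :: "'d \<Rightarrow> 'c \<Rightarrow> 'c"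
  note mul_closed = env_semigroup[OF \<Gamma>, folded mul_def]
  have mul_assoc: "mul (mul p q) r = mul p (mul q r)" if "p \<in> env I \<Gamma>" "q \<in> env I \<Gamma>" "r \<in> env I \<Gamma>" for p q r
    unfolding mul_def by (rule P.mul_assoc) (use that env_subset[OF \<Gamma>] in blast)+
  have pw: "pointwise I (mul p q) c' = pointwise I p (pointwise I q c')"
    if "c' \<in> topspace (product_topology (\<lambda>_. X) I)" for p q c'
    unfolding mul_def by (rule pointwise_compose[OF \<Gamma> that])
  define U where "U = (\<lambda>i\<in>I. if i \<in> J then u else \<phi> \<one>)"
  have U: "U \<in> env I \<Gamma>" unfolding U_def using idem u by blast
  obtain v where v: "v \<in> env I \<Gamma>" "z = pointwise I v c"
    using z orbit_closure_eq[OF \<Gamma> c] by blast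
  have vU: "mul v U \<in> env I \<Gamma>" using mul_closed v U by blast
  \<comment> \<open>The left ideal generated by \<open>mul v U\<close> is closed and closed under
    products, so it contains an idempotent \<open>w\<close>.\<close>
  have "\<exists>w\<in>(\<lambda>e. mul e (mul v U)) ` env I \<Gamma>. mul w w = w"
    unfolding mul_def
  proof (rule P.exists_idempotent, unfold mul_def[symmetric])
    show "closedin (product_topology (\<lambda>_. maps_top) I) ((\<lambda>e. mul e (mul v U)) ` env I \<Gamma>)"
    proof -
      have "closedin (product_topology (\<lambda>_. maps_top) I) (env I \<Gamma>)" by (simp add: env_def)
      moreover have "mul v U \<in> topspace (product_topology (\<lambda>_. maps_top) I)"
        using vU env_subset[OF \<Gamma>] by blast
      ultimately show ?thesis using P.closedin_right_mul_image[folded mul_def] by blast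
    qed
    show "mul p q \<in> (\<lambda>e. mul e (mul v U)) ` env I \<Gamma>"
      if pq: "p \<in> (\<lambda>e. mul e (mul v U)) ` env I \<Gamma>" "q \<in> (\<lambda>e. mul e (mul v U)) ` env I \<Gamma>" for p q
    proof -
      obtain e where e: "e \<in> env I \<Gamma>" "q = mul e (mul v U)" using pq by blast
      have "p \<in> env I \<Gamma>" using pq mul_closed vU by blast
      then have "mul p q = mul (mul p e) (mul v U)" "mul p e \<in> env I \<Gamma>"
        using mul_assoc[of p e "mul v U"] e vU mul_closed by auto
      then show ?thesis by blast
    qed
  qed (use v in blast)
  then obtain e where e: "e \<in> env I \<Gamma>" and w_idem: "mul (mul e (mul v U)) (mul e (mul v U)) = mul e (mul v U)"
    by blast
  define w where "w = mul e (mul v U)"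
  have ev: "mul e v \<in> env I \<Gamma>" using mul_closed e v by blast
  have w_eq: "w = mul (mul e v) U" using mul_assoc e v U by (simp add: w_def)
  \<comment> \<open>On \<open>J\<close>, \<open>w i\<close> is an idempotent of the form
    \<open>compose (topspace X) r u\<close> with \<open>r\<close> in \<open>ellis\<close>, hence
    absorbed by \<open>u\<close>; off \<open>J\<close>, both entries are the identity.\<close>
  have "compose (topspace X) (U i) (w i) = U i" if i: "i \<in> I" for i
  proof (cases "i \<in> J")
    case True
    have "w i = compose (topspace X) (mul e v i) (U i)"
      using i w_eq mul_def[of "mul e v" U] by simp
    then have "w i = compose (topspace X) (mul e v i) u"
      using True i by (simp add: U_def)
    moreover have "compose (topspace X) (w i) (w i) = w i"
      using fun_cong[OF w_idem[folded w_def], of i] mul_def[of w w] i by simp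
    ultimately show ?thesis
      using u_absorb[OF env_coordinate_in_ellis[OF \<Gamma> ev i]] True i by (simp add: U_def)
  next
    case False
    have "w \<in> env I \<Gamma>" using mul_closed e vU w_def by blast
    then have "w i = \<phi> \<one>" using env_coordinate_trivial[OF \<Gamma> _ i] triv False i by blast
    then show ?thesis
      using False i compose_action_one action_in_maps[OF one_closed] by (simp add: U_def)
  qed
  then have "mul U w = U" by (auto simp: mul_def U_def fun_eq_iff)
  have Uc: "pointwise I U c = c"
    using c y u(3) by (auto simp: pointwise_def U_def fun_eq_iff PiE_iff extensional_def action_one)
  have z_top: "z \<in> topspace (product_topology (\<lambda>_. X) I)"
    using z unfolding orbit_closure_def by (meson closure_of_subset_topspace subsetD)
  have Ue: "mul U e \<in> env I \<Gamma>" using mul_closed U e by blast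
  \<comment> \<open>Applying \<open>mul U w = U\<close> to \<open>c\<close>, which \<open>U\<close>
    fixes, writes \<open>c\<close> as the image under \<open>mul U e\<close> of
    \<open>z = pointwise I v c\<close>; this is the element returning \<open>z\<close> to
    \<open>c\<close>.\<close>
  have "mul U w = mul (mul U e) (mul v U)" using mul_assoc U e vU by (simp add: w_def)
  then have "c = pointwise I (mul (mul U e) (mul v U)) c" using Uc \<open>mul U w = U\<close> by simp
  also have "\<dots> = pointwise I (mul U e) z" using pw[OF c] Uc v(2) by simp
  finally show ?thesis using Ue orbit_closure_eq[OF \<Gamma> z_top] by blast
qed

section \<open>The Host-Kra cube group\<close>

lemma closure_of_joint_image:
  assumes "compact_space S" "Hausdorff_space S" "compact_space S'"
    and "\<And>a. a \<in> A \<Longrightarrow> f a \<in> topspace S" "\<And>a. a \<in> A \<Longrightarrow> g a \<in> topspace S'"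
    and z: "z \<in> S closure_of f ` A"
  obtains w where "(z, w) \<in> prod_topology S S' closure_of (\<lambda>a. (f a, g a)) ` A"
proof -
  have "fst ` (prod_topology S S' closure_of (\<lambda>a. (f a, g a)) ` A)
      = S closure_of (fst ` (\<lambda>a. (f a, g a)) ` A)"
    using assms by (intro closure_of_continuous_image continuous_map_fst)
      (auto simp: compact_space_prod_topology)
  also have "fst ` (\<lambda>a. (f a, g a)) ` A = f ` A" by (simp add: image_image)
  finally show thesis using z that by force
qed

section \<open>Vertices of the cube and projections onto faces through \<open>ones n\<close>\<close>

lemma cube_coordinate: "\<lbrakk>\<omega> \<in> cube n; j \<in> {1..n}\<rbrakk> \<Longrightarrow> \<omega> j = 0 \<or> \<omega> j = 1"
  by (auto simp: cube_def PiE_iff)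

lemma ones_in_cube: "ones n \<in> cube n"
  by (auto simp: cube_def ones_def)

lemma cube_eq_onesI: "\<lbrakk>\<omega> \<in> cube n; \<And>j. j \<in> {1..n} \<Longrightarrow> \<omega> j = 1\<rbrakk> \<Longrightarrow> \<omega> = ones n"
  by (auto simp: cube_def ones_def PiE_iff extensional_def fun_eq_iff)

text \<open>The projection of the cube onto its face of dimension \<open>k\<close> (for
  \<open>k \<le> n\<close>) in the first \<open>k\<close> directions through
  \<open>ones n\<close>.\<close>

definition retract :: "nat \<Rightarrow> nat \<Rightarrow> (nat \<Rightarrow> nat) \<Rightarrow> nat \<Rightarrow> nat" where
  "retract n k \<omega> = (\<lambda>j\<in>{1..n}. if j \<le> k then \<omega> j else 1)"

lemma retract_in_cube: "\<omega> \<in> cube n \<Longrightarrow> retract n k \<omega> \<in> cube n"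
  by (auto simp: cube_def retract_def PiE_iff)

lemma retract_ones: "retract n k (ones n) = ones n"
  by (auto simp: retract_def ones_def fun_eq_iff)

lemma retract_eq:
  assumes "\<omega> \<in> cube n" "\<And>j. j \<in> {Suc k..n} \<Longrightarrow> \<omega> j = 1"
  shows "retract n k \<omega> = \<omega>"
proof
  fix j show "retract n k \<omega> j = \<omega> j"
    using assms(1) assms(2)[of j] by (cases "j \<in> {1..n}") (auto simp: retract_def cube_def PiE_iff extensional_def)
qed

context group
begin

lemma face_elem_in_carrier:
  "h \<in> carrier G \<Longrightarrow> face_elem G n h F \<in> carrier (product_group (cube n) (\<lambda>_. G))"
  by (auto simp: face_elem_def)

lemma subgroup_host_kra: "subgroup (host_kra G n) (product_group (cube n) (\<lambda>_. G))"
  unfolding host_kra_def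
  by (rule group.generate_is_subgroup) (simp, use face_elem_in_carrier in blast)

lemma face_elem_in_host_kra:
  "\<lbrakk>h \<in> carrier G; j \<in> {1..n}; a \<in> {0, 1}\<rbrakk> \<Longrightarrow> face_elem G n h {\<omega> \<in> cube n. \<omega> j = a} \<in> host_kra G n"
  unfolding host_kra_def by (rule generate.incl) (auto simp: hyperfaces_def)

lemma host_kra_coordinate: "\<lbrakk>\<gamma> \<in> host_kra G n; \<omega> \<in> cube n\<rbrakk> \<Longrightarrow> \<gamma> \<omega> \<in> carrier G"
  using subgroup.subset[OF subgroup_host_kra] by auto

lemma host_kra_mult:
  "\<lbrakk>\<gamma> \<in> host_kra G n; \<delta> \<in> host_kra G n\<rbrakk> \<Longrightarrow> (\<lambda>\<omega>\<in>cube n. \<gamma> \<omega> \<otimes> \<delta> \<omega>) \<in> host_kra G n"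
  using subgroup.m_closed[OF subgroup_host_kra, of \<gamma> n \<delta>] by simp

text \<open>Multiply the face elements of two opposite hyperfaces. The assumption on
  \<open>n\<close> guarantees that coordinate 1 exists.\<close>

lemma host_kra_const:
  assumes "n \<ge> 1" "h \<in> carrier G"
  shows "(\<lambda>\<omega>\<in>cube n. h) \<in> host_kra G n"
proof -
  have "(\<lambda>\<omega>\<in>cube n. face_elem G n h {\<omega> \<in> cube n. \<omega> 1 = 0} \<omega> \<otimes> face_elem G n h {\<omega> \<in> cube n. \<omega> 1 = 1} \<omega>)
      \<in> host_kra G n"
    using assms by (intro host_kra_mult face_elem_in_host_kra) auto
  also have "(\<lambda>\<omega>\<in>cube n. face_elem G n h {\<omega> \<in> cube n. \<omega> 1 = 0} \<omega> \<otimes> face_elem G n h {\<omega> \<in> cube n. \<omega> 1 = 1} \<omega>)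
      = (\<lambda>\<omega>\<in>cube n. h)"
  proof (rule restrict_ext)
    fix \<omega> assume "\<omega> \<in> cube n"
    moreover from this have "\<omega> 1 = 0 \<or> \<omega> 1 = 1" using assms(1) by (intro cube_coordinate) auto
    ultimately show "face_elem G n h {\<omega> \<in> cube n. \<omega> 1 = 0} \<omega> \<otimes> face_elem G n h {\<omega> \<in> cube n. \<omega> 1 = 1} \<omega> = h"
      using assms(2) by (auto simp: face_elem_def)
  qed
  finally show ?thesis .
qed

text \<open>Pulling back along \<open>retract\<close> respects products and inverses, so it suffices
  to follow the generators.\<close>

lemma host_kra_retract:
  assumes "n \<ge> 1" "\<gamma> \<in> host_kra G n"
  shows "(\<lambda>\<omega>\<in>cube n. \<gamma> (retract n k \<omega>)) \<in> host_kra G n"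
proof -
  define gens where "gens = {face_elem G n h F | h F. h \<in> carrier G \<and> F \<in> hyperfaces n}"
  have gens: "(\<lambda>\<omega>\<in>cube n. \<gamma> (retract n k \<omega>)) \<in> host_kra G n" if \<gamma>: "\<gamma> \<in> gens" for \<gamma>
  proof -
    obtain h j a where h: "h \<in> carrier G" "j \<in> {1..n}" "a \<in> {0, 1}"
      and \<gamma>_eq: "\<gamma> = face_elem G n h {\<omega> \<in> cube n. \<omega> j = a}"
      using \<gamma> unfolding gens_def hyperfaces_def by blast
    \<comment> \<open>The preimage of the hyperface under \<open>retract\<close> is respectively the
      hyperface itself, the whole cube, or empty.\<close>
    consider "j \<le> k" | "j > k" "a = 1" | "j > k" "a = 0" using h(3) by fastforce
    then show ?thesis
    proof cases
      case 1
      then have "(\<lambda>\<omega>\<in>cube n. \<gamma> (retract n k \<omega>)) = \<gamma>"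
        using h(2) retract_in_cube by (auto simp: \<gamma>_eq face_elem_def fun_eq_iff retract_def)
      then show ?thesis using face_elem_in_host_kra h \<gamma>_eq by simp
    next
      case 2
      then have "(\<lambda>\<omega>\<in>cube n. \<gamma> (retract n k \<omega>)) = (\<lambda>\<omega>\<in>cube n. h)"
        using h(2) retract_in_cube by (auto simp: \<gamma>_eq face_elem_def fun_eq_iff retract_def)
      then show ?thesis using host_kra_const assms(1) h(1) by simp
    next
      case 3
      then have "(\<lambda>\<omega>\<in>cube n. \<gamma> (retract n k \<omega>)) = (\<lambda>\<omega>\<in>cube n. \<one>)"
        using h(2) retract_in_cube by (auto simp: \<gamma>_eq face_elem_def fun_eq_iff retract_def)
      then show ?thesis using host_kra_const assms(1) by simp
    qed
  qed
  have "\<gamma> \<in> generate (product_group (cube n) (\<lambda>_. G)) gens"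
    using assms(2) unfolding host_kra_def gens_def .
  then show ?thesis
  proof (induction rule: generate.induct)
    case one
    have "(\<lambda>\<omega>\<in>cube n. \<one>\<^bsub>product_group (cube n) (\<lambda>_. G)\<^esub> (retract n k \<omega>)) = (\<lambda>\<omega>\<in>cube n. \<one>)"
      using retract_in_cube by (auto intro!: restrict_ext)
    then show ?case using host_kra_const[OF assms(1) one_closed] by (simp only:)
  next
    case (incl h)
    then show ?case by (rule gens)
  next
    \<comment> \<open>\<open>generate\<close> adjoins inverses of generators only, so the pullback
      of \<open>h\<close> is already covered by \<open>gens\<close> and just has to be
      inverted.\<close>
    case (inv h)
    have "h \<in> carrier (product_group (cube n) (\<lambda>_. G))"
      using inv face_elem_in_carrier unfolding gens_def by blast
    then have h: "h \<in> (\<Pi>\<^sub>E i\<in>cube n. carrier G)" by simp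
    let ?p = "\<lambda>\<omega>\<in>cube n. h (retract n k \<omega>)"
    have p: "?p \<in> host_kra G n" by (rule gens[OF inv])
    then have "?p \<in> (\<Pi>\<^sub>E i\<in>cube n. carrier G)"
      using subgroup.subset[OF subgroup_host_kra, of n] unfolding carrier_product_group by blast
    then have "inv\<^bsub>product_group (cube n) (\<lambda>_. G)\<^esub> ?p = (\<lambda>\<omega>\<in>cube n. inv (?p \<omega>))"
      by (rule inv_product_group) simp
    also have "\<dots> = (\<lambda>\<omega>\<in>cube n. (inv\<^bsub>product_group (cube n) (\<lambda>_. G)\<^esub> h) (retract n k \<omega>))"
      using retract_in_cube inv_product_group[OF h] by (auto intro!: restrict_ext)
    finally show ?case using subgroup.m_inv_closed[OF subgroup_host_kra p] by (simp only:)
  next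
    case (eng h1 h2)
    have "(\<lambda>\<omega>\<in>cube n. (h1 \<otimes>\<^bsub>product_group (cube n) (\<lambda>_. G)\<^esub> h2) (retract n k \<omega>)) =
      (\<lambda>\<omega>\<in>cube n. (\<lambda>\<omega>\<in>cube n. h1 (retract n k \<omega>)) \<omega> \<otimes> (\<lambda>\<omega>\<in>cube n. h2 (retract n k \<omega>)) \<omega>)"
      using retract_in_cube by (auto intro!: restrict_ext)
    then show ?case using host_kra_mult[OF eng.IH] by (simp only:)
  qed
qed

end

section \<open>The subgroup \<open>F\<close> and a way of producing its elements\<close>

definition pointed_host_kra :: "('a, 'm) monoid_scheme \<Rightarrow> nat \<Rightarrow> ((nat \<Rightarrow> nat) \<Rightarrow> 'a) set" where
  "pointed_host_kra G n = {\<gamma> \<in> host_kra G n. \<gamma> (ones n) = \<one>\<^bsub>G\<^esub>}"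

text \<open>Normalises an element to be trivial at \<open>ones n\<close> while keeping it unchanged
  on the hyperface of direction \<open>j\<close> that avoids \<open>ones n\<close>.\<close>

definition twist :: "('a, 'm) monoid_scheme \<Rightarrow> nat \<Rightarrow> nat \<Rightarrow> ((nat \<Rightarrow> nat) \<Rightarrow> 'a) \<Rightarrow> (nat \<Rightarrow> nat) \<Rightarrow> 'a" where
  "twist G n j \<gamma> = (\<lambda>\<omega>\<in>cube n. if \<omega> j = 0 then \<gamma> \<omega> else inv\<^bsub>G\<^esub> \<gamma> (ones n) \<otimes>\<^bsub>G\<^esub> \<gamma> \<omega>)"

context group
begin

lemma subgroup_pointed_host_kra:
  "subgroup (pointed_host_kra G n) (product_group (cube n) (\<lambda>_. G))"
proof -
  interpret P: group "product_group (cube n) (\<lambda>_. G)" by simp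
  interpret H: subgroup "host_kra G n" "product_group (cube n) (\<lambda>_. G)" by (rule subgroup_host_kra)
  show ?thesis
  proof (rule P.subgroupI)
    show "pointed_host_kra G n \<subseteq> carrier (product_group (cube n) (\<lambda>_. G))"
      using H.subset by (auto simp: pointed_host_kra_def)
    have "\<one>\<^bsub>product_group (cube n) (\<lambda>_. G)\<^esub> \<in> pointed_host_kra G n"
      using H.one_closed ones_in_cube[of n] by (simp add: pointed_host_kra_def)
    then show "pointed_host_kra G n \<noteq> {}" by blast
  next
    fix \<gamma> assume \<gamma>: "\<gamma> \<in> pointed_host_kra G n"
    then have "\<gamma> \<in> (\<Pi>\<^sub>E i\<in>cube n. carrier G)" using H.subset by (auto simp: pointed_host_kra_def)
    then have "inv\<^bsub>product_group (cube n) (\<lambda>_. G)\<^esub> \<gamma> = (\<lambda>\<omega>\<in>cube n. inv (\<gamma> \<omega>))"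
      by (rule inv_product_group) simp
    then show "inv\<^bsub>product_group (cube n) (\<lambda>_. G)\<^esub> \<gamma> \<in> pointed_host_kra G n"
      using H.m_inv_closed[of \<gamma>] \<gamma> ones_in_cube[of n] by (simp add: pointed_host_kra_def)
  next
    fix \<gamma> \<delta> assume "\<gamma> \<in> pointed_host_kra G n" "\<delta> \<in> pointed_host_kra G n"
    then show "\<gamma> \<otimes>\<^bsub>product_group (cube n) (\<lambda>_. G)\<^esub> \<delta> \<in> pointed_host_kra G n"
      using host_kra_mult[of \<gamma> n \<delta>] ones_in_cube[of n] by (simp add: pointed_host_kra_def)
  qed
qed

lemma face_elem_in_pointed_host_kra:
  "\<lbrakk>h \<in> carrier G; j \<in> {1..n}\<rbrakk> \<Longrightarrow> face_elem G n h {\<omega> \<in> cube n. \<omega> j = 0} \<in> pointed_host_kra G n"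
  using face_elem_in_host_kra[of h j n 0] ones_in_cube[of n]
  by (auto simp: pointed_host_kra_def face_elem_def ones_def)

text \<open>With \<open>g = \<gamma> (ones n)\<close>, the twist is \<gamma> multiplied on the left
  by the constant \<open>inv g\<close> and then by the face element of \<open>g\<close> on the
  hyperface \<open>\<omega> j = 0\<close>, where the two factors cancel.\<close>

lemma twist_in_pointed_host_kra:
  assumes j: "j \<in> {1..n}" and \<gamma>: "\<gamma> \<in> host_kra G n"
  shows "twist G n j \<gamma> \<in> pointed_host_kra G n"
proof -
  define g where "g = \<gamma> (ones n)"
  have g: "g \<in> carrier G" using host_kra_coordinate \<gamma> ones_in_cube g_def by blast
  have "n \<ge> 1" using j by auto
  define \<delta> where "\<delta> = (\<lambda>\<omega>\<in>cube n. (\<lambda>\<omega>\<in>cube n. inv g) \<omega> \<otimes> \<gamma> \<omega>)"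
  have "\<delta> \<in> host_kra G n"
    unfolding \<delta>_def using \<gamma> g \<open>n \<ge> 1\<close> by (intro host_kra_mult host_kra_const) auto
  then have "(\<lambda>\<omega>\<in>cube n. face_elem G n g {\<omega> \<in> cube n. \<omega> j = 0} \<omega> \<otimes> \<delta> \<omega>) \<in> host_kra G n"
    using g j by (intro host_kra_mult face_elem_in_host_kra) auto
  also have "(\<lambda>\<omega>\<in>cube n. face_elem G n g {\<omega> \<in> cube n. \<omega> j = 0} \<omega> \<otimes> \<delta> \<omega>) = twist G n j \<gamma>"
    using g host_kra_coordinate[OF \<gamma>]
    by (auto simp: twist_def face_elem_def \<delta>_def g_def[symmetric] m_assoc[symmetric] intro!: restrict_ext)
  finally have "twist G n j \<gamma> \<in> host_kra G n" .
  moreover have "twist G n j \<gamma> (ones n) = \<one>"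
  proof -
    have "ones n j \<noteq> 0" using j by (simp add: ones_def)
    then show ?thesis using g ones_in_cube[of n] unfolding twist_def g_def by simp
  qed
  ultimately show ?thesis by (simp add: pointed_host_kra_def)
qed

end

section \<open>Orbit closures of cubes\<close>

context topological_dynamical_system
begin

lemma pow_compact: "compact_space (product_topology (\<lambda>_. X) I)"
  using compact by (simp add: compact_space_product_topology)

lemma pow_Hausdorff: "Hausdorff_space (product_topology (\<lambda>_. X) I)"
  using Hausdorff by (simp add: Hausdorff_space_product_topology)

lemma orbit_closure_subset: "orbit_closure I \<Gamma> c \<subseteq> topspace (product_topology (\<lambda>_. X) I)"
  unfolding orbit_closure_def by (rule closure_of_subset_topspace)

lemma closedin_orbit_closure: "closedin (product_topology (\<lambda>_. X) I) (orbit_closure I \<Gamma> c)"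
  by (simp add: orbit_closure_def)

lemma orbit_closure_mono: "\<Gamma> \<subseteq> \<Delta> \<Longrightarrow> orbit_closure I \<Gamma> c \<subseteq> orbit_closure I \<Delta> c"
  unfolding orbit_closure_def by (intro closure_of_mono image_mono)

lemma pointwise_action_in_topspace:
  assumes "subgroup \<Gamma> (product_group I (\<lambda>_. G))" "\<gamma> \<in> \<Gamma>" "c \<in> topspace (product_topology (\<lambda>_. X) I)"
  shows "pointwise I (\<lambda>i. \<phi> (\<gamma> i)) c \<in> topspace (product_topology (\<lambda>_. X) I)"
  using assms coordinate_closed[OF assms(1,2)]
  by (intro pointwise_in_topspace[OF assms(1)] action_in_maps) auto

lemma orbit_closure_trans:
  assumes \<Gamma>: "subgroup \<Gamma> (product_group I (\<lambda>_. G))"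
    and c: "c \<in> topspace (product_topology (\<lambda>_. X) I)"
    and z: "z \<in> orbit_closure I \<Gamma> c" and w: "w \<in> orbit_closure I \<Gamma> z"
  shows "w \<in> orbit_closure I \<Gamma> c"
proof -
  have "z \<in> topspace (product_topology (\<lambda>_. X) I)" using z orbit_closure_subset by blast
  then obtain p q where p: "p \<in> env I \<Gamma>" "z = pointwise I p c" and q: "q \<in> env I \<Gamma>" "w = pointwise I q z"
    using z w orbit_closure_eq[OF \<Gamma>] c by blast
  have "w = pointwise I (\<lambda>i\<in>I. compose (topspace X) (q i) (p i)) c"
    unfolding pointwise_compose[OF \<Gamma> c] q(2) p(2) ..
  then show ?thesis
    unfolding orbit_closure_eq[OF \<Gamma> c] using env_semigroup[OF \<Gamma> q(1) p(1)] by blast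
qed

lemma action_mem_orbit_closure:
  assumes \<Gamma>: "subgroup \<Gamma> (product_group I (\<lambda>_. G))" and "\<gamma> \<in> \<Gamma>"
    and c: "c \<in> topspace (product_topology (\<lambda>_. X) I)"
  shows "pointwise I (\<lambda>i. \<phi> (\<gamma> i)) c \<in> orbit_closure I \<Gamma> c"
  unfolding orbit_closure_def using pointwise_action_in_topspace[OF \<Gamma> _ c] assms(2)
  by (intro subsetD[OF closure_of_subset]) auto

text \<open>Placing one map at all coordinates in \<open>J\<close> and the identity elsewhere is
  continuous, and \<open>gen\<close> puts the tuples coming from \<open>G\<close> into the image of
  \<Gamma>; hence limits land in the closure.\<close>

lemma ellis_in_env:
  assumes \<Gamma>: "subgroup \<Gamma> (product_group I (\<lambda>_. G))"
    and gen: "\<And>g. g \<in> carrier G \<Longrightarrow> (\<lambda>i\<in>I. if i \<in> J then g else \<one>) \<in> \<Gamma>"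
    and u: "u \<in> ellis"
  shows "(\<lambda>i\<in>I. if i \<in> J then u else \<phi> \<one>) \<in> env I \<Gamma>"
proof -
  let ?f = "\<lambda>p. \<lambda>i\<in>I. if i \<in> J then p else \<phi> \<one>"
  have "continuous_map maps_top (product_topology (\<lambda>_. maps_top) I) ?f"
    unfolding continuous_map_componentwise[where I = I]
  proof (intro conjI ballI)
    fix i assume "i \<in> I"
    then show "continuous_map maps_top maps_top (\<lambda>p. ?f p i)"
      using action_in_maps[OF one_closed] by (cases "i \<in> J") auto
  qed auto
  from continuous_map_image_closure_subset[OF this, of "\<phi> ` carrier G"]
  have "?f u \<in> product_topology (\<lambda>_. maps_top) I closure_of ?f ` \<phi> ` carrier G"
    using u unfolding ellis_def by blast
  moreover have "?f ` \<phi> ` carrier G \<subseteq> (\<lambda>\<gamma>. \<lambda>i\<in>I. \<phi> (\<gamma> i)) ` \<Gamma>"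
  proof clarify
    fix g assume "g \<in> carrier G"
    moreover have "?f (\<phi> g) = (\<lambda>i\<in>I. \<phi> ((\<lambda>i\<in>I. if i \<in> J then g else \<one>) i))" by auto
    ultimately show "?f (\<phi> g) \<in> (\<lambda>\<gamma>. \<lambda>i\<in>I. \<phi> (\<gamma> i)) ` \<Gamma>" using gen by blast
  qed
  ultimately show ?thesis unfolding env_def using closure_of_mono by blast
qed

lemma ellis_in_env_host_kra:
  assumes "n \<ge> 1" "u \<in> ellis"
  shows "(\<lambda>\<omega>\<in>cube n. if \<omega> \<in> UNIV then u else \<phi> \<one>) \<in> env (cube n) (host_kra G n)"
  using assms host_kra_const by (intro ellis_in_env[OF subgroup_host_kra]) auto

text \<open>The hyperfaces \<open>\<omega> j = 0\<close> cover every vertex except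
  \<open>ones n\<close>. Multiplying the tuples that carry \<open>u\<close> on each of them gives
  the claim, since idempotency absorbs the overlaps.\<close>

lemma idempotent_in_env_pointed_host_kra:
  assumes u: "u \<in> ellis" and idem: "compose (topspace X) u u = u"
  shows "(\<lambda>\<omega>\<in>cube n. if \<omega> \<in> - {ones n} then u else \<phi> \<one>) \<in> env (cube n) (pointed_host_kra G n)"
proof -
  note \<Gamma> = subgroup_pointed_host_kra[of n]
  have u_top: "u \<in> topspace maps_top" using u ellis_subset by blast
  have face: "(\<lambda>\<omega>\<in>cube n. if \<omega> \<in> {\<omega>. \<omega> j = 0} then u else \<phi> \<one>) \<in> env (cube n) (pointed_host_kra G n)"
    if j: "j \<in> {1..n}" for j
  proof (rule ellis_in_env[OF \<Gamma> _ u])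
    fix g assume g: "g \<in> carrier G"
    have "(\<lambda>\<omega>\<in>cube n. if \<omega> \<in> {\<omega>. \<omega> j = 0} then g else \<one>) = face_elem G n g {\<omega> \<in> cube n. \<omega> j = 0}"
      unfolding face_elem_def by (rule restrict_ext) simp
    then show "(\<lambda>\<omega>\<in>cube n. if \<omega> \<in> {\<omega>. \<omega> j = 0} then g else \<one>) \<in> pointed_host_kra G n"
      using face_elem_in_pointed_host_kra[OF g j] by (simp only:)
  qed
  \<comment> \<open>Induction on the number \<open>m\<close> of hyperfaces multiplied so far,
    starting from the identity tuple.\<close>
  have "(\<lambda>\<omega>\<in>cube n. if \<exists>j\<in>{1..m}. \<omega> j = 0 then u else \<phi> \<one>) \<in> env (cube n) (pointed_host_kra G n)"
    if "m \<le> n" for m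
    using that
  proof (induction m)
    case 0
    have "(\<lambda>\<omega>\<in>cube n. \<phi> ((\<lambda>\<omega>\<in>cube n. \<one>) \<omega>)) \<in> env (cube n) (pointed_host_kra G n)"
      by (rule action_in_env[OF \<Gamma> coordinatewise_one_closed[OF \<Gamma>]])
    also have "(\<lambda>\<omega>\<in>cube n. \<phi> ((\<lambda>\<omega>\<in>cube n. \<one>) \<omega>)) = (\<lambda>\<omega>\<in>cube n. if \<exists>j\<in>{1..0}. \<omega> j = 0 then u else \<phi> \<one>)"
      by auto
    finally show ?case .
  next
    case (Suc m)
    have "(\<lambda>\<omega>\<in>cube n. if \<exists>j\<in>{1..Suc m}. \<omega> j = 0 then u else \<phi> \<one>) =
      (\<lambda>\<omega>\<in>cube n. compose (topspace X) ((\<lambda>\<omega>\<in>cube n. if \<omega> \<in> {\<omega>. \<omega> (Suc m) = 0} then u else \<phi> \<one>) \<omega>)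
         ((\<lambda>\<omega>\<in>cube n. if \<exists>j\<in>{1..m}. \<omega> j = 0 then u else \<phi> \<one>) \<omega>))"
    proof (rule restrict_ext)
      fix \<omega> assume \<omega>: "\<omega> \<in> cube n"
      have u1: "compose (topspace X) u (\<phi> \<one>) = u"
        unfolding id_eq_one[symmetric] using u_top by (intro compose_Id) (auto simp: PiE_iff)
      have 1: "compose (topspace X) (\<phi> \<one>) (\<phi> \<one>) = \<phi> \<one>" "compose (topspace X) (\<phi> \<one>) u = u"
        by (rule compose_action_one; use u_top action_in_maps[OF one_closed] in blast)+
      have ex: "(\<exists>j\<in>{1..Suc m}. \<omega> j = 0) \<longleftrightarrow> \<omega> (Suc m) = 0 \<or> (\<exists>j\<in>{1..m}. \<omega> j = 0)"
        by (auto simp: atLeastAtMostSuc_conv)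
      show "(if \<exists>j\<in>{1..Suc m}. \<omega> j = 0 then u else \<phi> \<one>) =
          compose (topspace X) ((\<lambda>\<omega>\<in>cube n. if \<omega> \<in> {\<omega>. \<omega> (Suc m) = 0} then u else \<phi> \<one>) \<omega>)
         ((\<lambda>\<omega>\<in>cube n. if \<exists>j\<in>{1..m}. \<omega> j = 0 then u else \<phi> \<one>) \<omega>)"
        unfolding ex using \<omega> u1 1 idem by (simp del: Id_compose) force
    qed
    also have "\<dots> \<in> env (cube n) (pointed_host_kra G n)"
      using Suc by (intro env_semigroup[OF \<Gamma>] face) auto
    finally show ?case .
  qed
  from this[OF order_refl] show ?thesis
  proof (rule back_subst[where P = "\<lambda>p. p \<in> env (cube n) (pointed_host_kra G n)"])
    show "(\<lambda>\<omega>\<in>cube n. if \<exists>j\<in>{1..n}. \<omega> j = 0 then u else \<phi> \<one>) =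
        (\<lambda>\<omega>\<in>cube n. if \<omega> \<in> - {ones n} then u else \<phi> \<one>)"
    proof (rule restrict_ext)
      fix \<omega> assume \<omega>: "\<omega> \<in> cube n"
      have "(\<exists>j\<in>{1..n}. \<omega> j = 0) \<longleftrightarrow> \<omega> \<noteq> ones n"
      proof
        show "\<omega> \<noteq> ones n" if "\<exists>j\<in>{1..n}. \<omega> j = 0" using that by (auto simp: ones_def)
        show "\<exists>j\<in>{1..n}. \<omega> j = 0" if "\<omega> \<noteq> ones n"
          using cube_eq_onesI[OF \<omega>] cube_coordinate[OF \<omega>] that by blast
      qed
      then show "(if \<exists>j\<in>{1..n}. \<omega> j = 0 then u else \<phi> \<one>) = (if \<omega> \<in> - {ones n} then u else \<phi> \<one>)"
        by simp
    qed
  qed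
qed

lemma const_cube_in_topspace:
  "x \<in> topspace X \<Longrightarrow> const_cube n x \<in> topspace (product_topology (\<lambda>_. X) (cube n))"
  by (auto simp: const_cube_def)

lemma corner_in_topspace:
  "\<lbrakk>x \<in> topspace X; y \<in> topspace X\<rbrakk> \<Longrightarrow> corner n x y \<in> topspace (product_topology (\<lambda>_. X) (cube n))"
  by (auto simp: corner_def)

lemma cube_action_eq_pointwise: "cube_action \<phi> n \<gamma> c = pointwise (cube n) (\<lambda>\<omega>. \<phi> (\<gamma> \<omega>)) c"
  by (simp add: cube_action_def pointwise_def)

end

section \<open>Minimality of constant points and corners, and reduction of cubes to
  constants\<close>

context minimal_system
begin

lemma mem_orbit_closure_host_kra_sym:
  assumes "n \<ge> 1" "y \<in> topspace X" "z \<in> orbit_closure (cube n) (host_kra G n) (const_cube n y)"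
  shows "const_cube n y \<in> orbit_closure (cube n) (host_kra G n) z"
proof (rule mem_orbit_closure_sym[OF subgroup_host_kra _ _ const_cube_in_topspace[OF assms(2)] assms(2) _ assms(3)])
  show "(\<lambda>\<omega>\<in>cube n. if \<omega> \<in> UNIV then u else \<phi> \<one>) \<in> env (cube n) (host_kra G n)" if "u \<in> ellis" for u
    by (rule ellis_in_env_host_kra[OF assms(1) that])
qed (auto simp: const_cube_def)

lemma mem_orbit_closure_pointed_host_kra_sym:
  assumes "x \<in> topspace X" "y \<in> topspace X"
    and "z \<in> orbit_closure (cube n) (pointed_host_kra G n) (corner n x y)"
  shows "corner n x y \<in> orbit_closure (cube n) (pointed_host_kra G n) z"
proof (rule mem_orbit_closure_sym[OF subgroup_pointed_host_kra _ _ corner_in_topspace[OF assms(1,2)] assms(1) _ assms(3)])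
  show "(\<lambda>\<omega>\<in>cube n. if \<omega> \<in> - {ones n} then u else \<phi> \<one>) \<in> env (cube n) (pointed_host_kra G n)"
    if "u \<in> ellis" "compose (topspace X) u u = u" for u
    by (rule idempotent_in_env_pointed_host_kra[OF that])
qed (auto simp: corner_def pointed_host_kra_def)

lemma corner_same: "corner n x x = const_cube n x"
  by (auto simp: corner_def const_cube_def)

text \<open>The diagonal copy of \<open>G\<close> lies in the cube group, and orbits in
  \<open>X\<close> are dense.\<close>

lemma const_mem_orbit_closure:
  assumes "n \<ge> 1" "x \<in> topspace X" "y \<in> topspace X"
  shows "const_cube n y \<in> orbit_closure (cube n) (host_kra G n) (const_cube n x)"
proof -
  have "continuous_map X (product_topology (\<lambda>_. X) (cube n)) (const_cube n)"
    by (auto simp: continuous_map_componentwise const_cube_def)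
  from continuous_map_image_closure_subset[OF this, of "orbit G \<phi> x"]
  have "const_cube n y \<in> product_topology (\<lambda>_. X) (cube n) closure_of const_cube n ` orbit G \<phi> x"
    using dense_orbit[OF assms(2)] assms(3) by blast
  moreover have "const_cube n ` orbit G \<phi> x \<subseteq>
      (\<lambda>\<gamma>. pointwise (cube n) (\<lambda>\<omega>. \<phi> (\<gamma> \<omega>)) (const_cube n x)) ` host_kra G n"
  proof clarify
    fix z assume "z \<in> orbit G \<phi> x"
    then obtain g where g: "g \<in> carrier G" "z = \<phi> g x" by (auto simp: orbit_def)
    have "const_cube n z = pointwise (cube n) (\<lambda>\<omega>. \<phi> ((\<lambda>\<omega>\<in>cube n. g) \<omega>)) (const_cube n x)"
      using g by (auto simp: const_cube_def pointwise_def)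
    then show "const_cube n z \<in> (\<lambda>\<gamma>. pointwise (cube n) (\<lambda>\<omega>. \<phi> (\<gamma> \<omega>)) (const_cube n x)) ` host_kra G n"
      using host_kra_const[OF assms(1) g(1)] by blast
  qed
  ultimately show ?thesis unfolding orbit_closure_def using closure_of_mono by blast
qed

text \<open>Constants lie in each other's orbit closures, so the union over all base points in the
  definition of cubes collapses to one orbit closure with an arbitrary base point.\<close>

lemma dynamical_cubes_eq:
  assumes "n \<ge> 1" "x \<in> topspace X"
  shows "dynamical_cubes G X \<phi> n = orbit_closure (cube n) (host_kra G n) (const_cube n x)"
proof
  note H = subgroup_host_kra[of n]
  show "dynamical_cubes G X \<phi> n \<subseteq> orbit_closure (cube n) (host_kra G n) (const_cube n x)"
    unfolding dynamical_cubes_def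
  proof (rule closure_of_minimal[OF _ closedin_orbit_closure], clarify)
    fix \<gamma> y assume "\<gamma> \<in> host_kra G n" "y \<in> topspace X"
    then have "cube_action \<phi> n \<gamma> (const_cube n y) \<in> orbit_closure (cube n) (host_kra G n) (const_cube n y)"
      unfolding cube_action_eq_pointwise
      by (intro action_mem_orbit_closure[OF H] const_cube_in_topspace)
    then show "cube_action \<phi> n \<gamma> (const_cube n y) \<in> orbit_closure (cube n) (host_kra G n) (const_cube n x)"
      by (rule orbit_closure_trans[OF H const_cube_in_topspace[OF assms(2)]
            const_mem_orbit_closure[OF assms \<open>y \<in> topspace X\<close>]])
  qed
  show "orbit_closure (cube n) (host_kra G n) (const_cube n x) \<subseteq> dynamical_cubes G X \<phi> n"
    unfolding dynamical_cubes_def orbit_closure_def cube_action_eq_pointwise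
    by (rule closure_of_mono) (use assms(2) in blast)
qed

text \<open>
  If \<open>\<gamma>\<close> moves \<open>c\<close> close to the constant \<open>y\<close>, then the twist of \<open>\<gamma>\<close> applied to \<open>c\<close> and the twist of
  the pullback of \<open>\<gamma>\<close> along \<^const>\<open>retract\<close> applied to the constant \<open>y\<close> almost agree on the face of
  dimension \<open>Suc k\<close>. In the limit \<open>c\<close> is moved by \<open>F\<close> to a point \<open>c1\<close> that agrees on this face with a
  point \<open>d1\<close> of the minimal set of the constant; moving \<open>d1\<close> back to the constant carries \<open>c1\<close> along.
\<close>
lemma extend_constant_face:
  assumes k: "k < n" and y: "y \<in> topspace X"
    and c: "c \<in> orbit_closure (cube n) (host_kra G n) (const_cube n y)"
    and c_const: "\<And>\<omega>. \<lbrakk>\<omega> \<in> cube n; \<And>j. j \<in> {Suc k..n} \<Longrightarrow> \<omega> j = 1\<rbrakk> \<Longrightarrow> c \<omega> = y"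
  obtains c' where "c' \<in> orbit_closure (cube n) (pointed_host_kra G n) c"
    "\<And>\<omega>. \<lbrakk>\<omega> \<in> cube n; \<And>j. j \<in> {Suc (Suc k)..n} \<Longrightarrow> \<omega> j = 1\<rbrakk> \<Longrightarrow> c' \<omega> = y"
proof -
  define I where "I = cube n"
  define XI where "XI = product_topology (\<lambda>_. X) I"
  define H where "H = host_kra G n"
  define F where "F = pointed_host_kra G n"
  define act where "act \<gamma> c = pointwise I (\<lambda>\<omega>. \<phi> (\<gamma> \<omega>)) c" for \<gamma> c
  define \<tau> where "\<tau> \<gamma> = twist G n (Suc k) \<gamma>" for \<gamma>
  define \<rho> where "\<rho> \<gamma> = (\<lambda>\<omega>\<in>I. \<gamma> (retract n k \<omega>))" for \<gamma> :: "(nat \<Rightarrow> nat) \<Rightarrow> 'a"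
  note defs = I_def XI_def H_def F_def
  have n: "n \<ge> 1" "Suc k \<in> {1..n}" using k by auto
  have sH: "subgroup H (product_group I (\<lambda>_. G))" and sF: "subgroup F (product_group I (\<lambda>_. G))"
    unfolding defs by (rule subgroup_host_kra subgroup_pointed_host_kra)+
  have oc: "orbit_closure I \<Gamma> c = XI closure_of ((\<lambda>\<gamma>. act \<gamma> c) ` \<Gamma>)" for \<Gamma> c
    by (simp add: orbit_closure_def act_def XI_def)
  have compact_XI: "compact_space XI" and Hausdorff_XI: "Hausdorff_space XI"
    unfolding XI_def by (rule pow_compact pow_Hausdorff)+
  have compact_XI2: "compact_space (prod_topology XI XI)"
    using compact_XI by (simp add: compact_space_prod_topology)
  have act_top: "act \<gamma> c \<in> topspace XI" if "\<gamma> \<in> H \<union> F" "c \<in> topspace XI" for \<gamma> c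
    using that pointwise_action_in_topspace[OF sH] pointwise_action_in_topspace[OF sF]
    unfolding act_def XI_def by blast
  have c_top: "c \<in> topspace XI" using c orbit_closure_subset unfolding XI_def I_def by blast
  have y_top: "const_cube n y \<in> topspace XI" unfolding defs by (rule const_cube_in_topspace[OF y])
  have \<tau>F: "\<tau> \<gamma> \<in> F" if "\<gamma> \<in> H" for \<gamma>
    using that twist_in_pointed_host_kra[OF n(2)] unfolding \<tau>_def H_def F_def by blast
  have \<rho>H: "\<rho> \<gamma> \<in> H" if "\<gamma> \<in> H" for \<gamma>
    using that host_kra_retract[OF n(1)] unfolding \<rho>_def H_def I_def by blast
  have eval: "continuous_map XI X (\<lambda>c. c \<omega>)" if "\<omega> \<in> I" for \<omega>
    unfolding XI_def using that by (rule continuous_map_product_projection)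

  \<comment> \<open>Minimality of the constant under \<open>H\<close> lets \<open>c\<close> return
    to it. The two twisted images are then followed along the same \<gamma>, with limits
    \<open>c1\<close> and \<open>d1\<close>.\<close>
  have "const_cube n y \<in> XI closure_of (\<lambda>\<gamma>. act \<gamma> c) ` H"
    using mem_orbit_closure_host_kra_sym[OF n(1) y c] unfolding oc[symmetric] I_def H_def .
  from closure_of_joint_image[OF compact_XI Hausdorff_XI compact_XI2 _ _ this,
      of "\<lambda>\<gamma>. (act (\<tau> \<gamma>) c, act (\<tau> (\<rho> \<gamma>)) (const_cube n y))"]
  obtain w where "(const_cube n y, w) \<in> prod_topology XI (prod_topology XI XI) closure_of
      (\<lambda>\<gamma>. (act \<gamma> c, act (\<tau> \<gamma>) c, act (\<tau> (\<rho> \<gamma>)) (const_cube n y))) ` H"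
    using act_top c_top y_top \<tau>F \<rho>H by auto
  then obtain c1 d1 where joint: "(const_cube n y, c1, d1) \<in> prod_topology XI (prod_topology XI XI) closure_of
      (\<lambda>\<gamma>. (act \<gamma> c, act (\<tau> \<gamma>) c, act (\<tau> (\<rho> \<gamma>)) (const_cube n y))) ` H" (is "_ \<in> ?T closure_of ?A")
    by (cases w) auto
  have cont1: "continuous_map ?T XI (\<lambda>p. fst p)"
    by (intro continuous_intros)
  have cont2: "continuous_map ?T XI (\<lambda>p. fst (snd p))"
    by (intro continuous_map_compose[OF continuous_map_snd continuous_map_fst, unfolded o_def])
  have cont3: "continuous_map ?T XI (\<lambda>p. snd (snd p))"
    by (intro continuous_map_compose[OF continuous_map_snd continuous_map_snd, unfolded o_def])
  \<comment> \<open>Equality of two continuous functions into a Hausdorff space passes to the joint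
    limit; all coordinate comparisons below go through this.\<close>
  have joint_eq: "f (const_cube n y, c1, d1) = g (const_cube n y, c1, d1)"
    if "continuous_map ?T X f" "continuous_map ?T X g"
      "\<And>\<gamma>. \<gamma> \<in> H \<Longrightarrow> f (act \<gamma> c, act (\<tau> \<gamma>) c, act (\<tau> (\<rho> \<gamma>)) (const_cube n y)) =
        g (act \<gamma> c, act (\<tau> \<gamma>) c, act (\<tau> (\<rho> \<gamma>)) (const_cube n y))" for f g
    by (rule forall_in_closure_of_eq[OF joint Hausdorff that(1,2)]) (use that(3) in blast)
  have c1: "c1 \<in> orbit_closure I F c"
  proof -
    have "c1 \<in> XI closure_of ((\<lambda>p. fst (snd p)) ` ?A)"
      using continuous_map_image_closure_subset[OF cont2, of ?A] joint by force
    moreover have "(\<lambda>p. fst (snd p)) ` ?A \<subseteq> (\<lambda>\<gamma>. act \<gamma> c) ` F" using \<tau>F by auto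
    ultimately show ?thesis unfolding oc using closure_of_mono by blast
  qed
  have d1: "d1 \<in> orbit_closure I F (const_cube n y)"
  proof -
    have "d1 \<in> XI closure_of ((\<lambda>p. snd (snd p)) ` ?A)"
      using continuous_map_image_closure_subset[OF cont3, of ?A] joint by force
    moreover have "(\<lambda>p. snd (snd p)) ` ?A \<subseteq> (\<lambda>\<gamma>. act \<gamma> (const_cube n y)) ` F" using \<tau>F \<rho>H by auto
    ultimately show ?thesis unfolding oc using closure_of_mono by blast
  qed
  have eq1: "c1 \<omega> = d1 \<omega>" if \<omega>: "\<omega> \<in> I" "\<And>j. j \<in> {Suc (Suc k)..n} \<Longrightarrow> \<omega> j = 1" for \<omega>
  proof -
    have r\<omega>: "retract n k \<omega> \<in> I" using retract_in_cube \<omega>(1) by (simp add: I_def)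
    have c_r: "c (retract n k \<omega>) = y"
      using r\<omega> by (intro c_const) (auto simp: I_def retract_def)
    show ?thesis
    proof (cases "\<omega> (Suc k) = 0")
      case True
      \<comment> \<open>At vertices with \<open>\<omega> (Suc k) = 0\<close> the twist changes
        nothing, so \<open>c1\<close> has the limit value of \<open>act \<gamma> c\<close>.\<close>
      have "c1 \<omega> = const_cube n y \<omega>"
        using joint_eq[OF continuous_map_compose[OF cont2 eval[OF \<omega>(1)]] continuous_map_compose[OF cont1 eval[OF \<omega>(1)]]]
          True \<omega>(1) by (simp add: \<tau>_def twist_def act_def pointwise_def I_def)
      \<comment> \<open>Here the pulled-back element acts on \<open>y\<close> as \<gamma> acts on
        \<open>c\<close> at the retracted vertex, because \<open>c\<close> has the value
        \<open>y\<close> there; that limit is again \<open>y\<close>.\<close>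
      moreover have "d1 \<omega> = const_cube n y (retract n k \<omega>)"
        using joint_eq[OF continuous_map_compose[OF cont3 eval[OF \<omega>(1)]] continuous_map_compose[OF cont1 eval[OF r\<omega>]]]
          True \<omega>(1) r\<omega> c_r by (simp add: \<tau>_def \<rho>_def twist_def act_def pointwise_def I_def const_cube_def)
      ultimately show ?thesis using \<omega>(1) r\<omega> by (simp add: const_cube_def I_def)
    next
      case False
      have "\<omega> j = 1" if "j \<in> {Suc k..n}" for j
        using False \<omega>(2)[of j] that cube_coordinate[of \<omega> n "Suc k"] \<omega>(1) n(2)
        unfolding I_def by (cases "j = Suc k") auto
      \<comment> \<open>This vertex is on the smaller face, where \<open>c \<omega> = y\<close>.
        Both twists apply the same group element to \<open>y\<close>, since \<open>retract\<close>
        also fixes \<open>ones n\<close>.\<close>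
      then have "retract n k \<omega> = \<omega>" using retract_eq \<omega>(1) unfolding I_def by blast
      then show ?thesis
        using joint_eq[OF continuous_map_compose[OF cont2 eval[OF \<omega>(1)]] continuous_map_compose[OF cont3 eval[OF \<omega>(1)]]]
          False \<omega>(1) c_r ones_in_cube[of n]
        by (simp add: \<tau>_def \<rho>_def twist_def act_def pointwise_def I_def const_cube_def retract_ones)
    qed
  qed
  have c1_top: "c1 \<in> topspace XI" and d1_top: "d1 \<in> topspace XI"
    using c1 d1 orbit_closure_subset unfolding XI_def by blast+
  \<comment> \<open>The constant is a corner with equal values, hence \<open>F\<close>-minimal:
    \<open>d1\<close> can be moved back to it, and \<open>c1\<close> is followed to
    \<open>c2\<close>. Since \<open>c1\<close> and \<open>d1\<close> agree on the larger face,
    \<open>c2\<close> has the value \<open>y\<close> there.\<close>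
  have "const_cube n y \<in> XI closure_of (\<lambda>\<gamma>. act \<gamma> d1) ` F"
    using mem_orbit_closure_pointed_host_kra_sym[OF y y, of d1 n] d1
    unfolding oc[symmetric] I_def F_def corner_same by blast
  from closure_of_joint_image[OF compact_XI Hausdorff_XI compact_XI _ _ this, of "\<lambda>\<gamma>. act \<gamma> c1"]
  obtain c2 where joint2: "(const_cube n y, c2) \<in> prod_topology XI XI closure_of (\<lambda>\<gamma>. (act \<gamma> d1, act \<gamma> c1)) ` F"
    (is "_ \<in> _ closure_of ?B")
    using act_top c1_top d1_top by auto
  have "c2 \<in> orbit_closure I F c1"
  proof -
    have "c2 \<in> XI closure_of (snd ` ?B)"
      using continuous_map_image_closure_subset[OF continuous_map_snd, of XI XI ?B] joint2 by force
    moreover have "snd ` ?B = (\<lambda>\<gamma>. act \<gamma> c1) ` F" by (simp add: image_image)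
    ultimately show ?thesis unfolding oc by simp
  qed
  then have "c2 \<in> orbit_closure I F c"
    using orbit_closure_trans[OF sF _ c1] c_top unfolding XI_def by blast
  moreover have "c2 \<omega> = y" if \<omega>: "\<omega> \<in> I" "\<And>j. j \<in> {Suc (Suc k)..n} \<Longrightarrow> \<omega> j = 1" for \<omega>
  proof -
    have "((\<lambda>c. c \<omega>) \<circ> fst) (const_cube n y, c2) = ((\<lambda>c. c \<omega>) \<circ> snd) (const_cube n y, c2)"
    proof (rule forall_in_closure_of_eq[OF joint2 Hausdorff])
      show "continuous_map (prod_topology XI XI) X ((\<lambda>c. c \<omega>) \<circ> fst)"
        "continuous_map (prod_topology XI XI) X ((\<lambda>c. c \<omega>) \<circ> snd)"
        using eval[OF \<omega>(1)] by (auto intro: continuous_map_compose continuous_map_fst continuous_map_snd)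
    qed (use eq1[OF \<omega>] in \<open>auto simp: act_def pointwise_def\<close>)
    then show ?thesis using \<omega>(1) by (simp add: const_cube_def I_def)
  qed
  ultimately show thesis using that unfolding I_def F_def by blast
qed

lemma const_mem_pointed_orbit_closure:
  assumes n: "n \<ge> 1" and c: "c \<in> dynamical_cubes G X \<phi> n"
  shows "const_cube n (c (ones n)) \<in> orbit_closure (cube n) (pointed_host_kra G n) c"
proof -
  define y where "y = c (ones n)"
  have "c \<in> topspace (product_topology (\<lambda>_. X) (cube n))"
    using c unfolding dynamical_cubes_def by (meson closure_of_subset_topspace subsetD)
  then have y: "y \<in> topspace X" using ones_in_cube[of n] by (auto simp: y_def)
  have c_H: "c \<in> orbit_closure (cube n) (host_kra G n) (const_cube n y)"
    using c dynamical_cubes_eq[OF n y] by simp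
  note top = subsetD[OF orbit_closure_subset]
  \<comment> \<open>Induction on the dimension \<open>k\<close> of the face on which the point is
    constant. For \<open>k = 0\<close> the face is the vertex \<open>ones n\<close> and
    \<open>c\<close> itself works; for \<open>k = n\<close> it is the whole cube.\<close>
  have "\<exists>c'\<in>orbit_closure (cube n) (pointed_host_kra G n) c.
      \<forall>\<omega>\<in>cube n. (\<forall>j\<in>{Suc k..n}. \<omega> j = 1) \<longrightarrow> c' \<omega> = y" if "k \<le> n" for k
    using that
  proof (induction k)
    case 0
    have "c \<in> orbit_closure (cube n) (pointed_host_kra G n) c"
    proof -
      have "pointwise (cube n) (\<lambda>\<omega>. \<phi> ((\<lambda>\<omega>\<in>cube n. \<one>) \<omega>)) c = c"
        using top[OF c_H] by (auto simp: pointwise_def fun_eq_iff PiE_iff extensional_def action_one)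
      then show ?thesis
        using action_mem_orbit_closure[OF subgroup_pointed_host_kra
            coordinatewise_one_closed[OF subgroup_pointed_host_kra] top[OF c_H]] by simp
    qed
    moreover have "\<forall>\<omega>\<in>cube n. (\<forall>j\<in>{Suc 0..n}. \<omega> j = 1) \<longrightarrow> c \<omega> = y"
      using cube_eq_onesI[of _ n] by (auto simp: y_def)
    ultimately show ?case by blast
  next
    case (Suc k)
    then obtain c' where c': "c' \<in> orbit_closure (cube n) (pointed_host_kra G n) c"
      and c'_const: "\<And>\<omega>. \<lbrakk>\<omega> \<in> cube n; \<And>j. j \<in> {Suc k..n} \<Longrightarrow> \<omega> j = 1\<rbrakk> \<Longrightarrow> c' \<omega> = y"
      by auto
    \<comment> \<open>Moving by \<open>F\<close> stays inside the \<open>H\<close>-orbit closure of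
      the constant, so the extension step applies again.\<close>
    have "pointed_host_kra G n \<subseteq> host_kra G n" by (auto simp: pointed_host_kra_def)
    then have "c' \<in> orbit_closure (cube n) (host_kra G n) c" using c' orbit_closure_mono by blast
    then have c'_H: "c' \<in> orbit_closure (cube n) (host_kra G n) (const_cube n y)"
      using orbit_closure_trans[OF subgroup_host_kra const_cube_in_topspace[OF y] c_H] by blast
    obtain c'' where c'': "c'' \<in> orbit_closure (cube n) (pointed_host_kra G n) c'"
      "\<And>\<omega>. \<lbrakk>\<omega> \<in> cube n; \<And>j. j \<in> {Suc (Suc k)..n} \<Longrightarrow> \<omega> j = 1\<rbrakk> \<Longrightarrow> c'' \<omega> = y"
    proof (rule extend_constant_face[OF _ y c'_H])
      show "k < n" using Suc.prems by simp
      show "c' \<omega> = y" if "\<omega> \<in> cube n" "\<And>j. j \<in> {Suc k..n} \<Longrightarrow> \<omega> j = 1" for \<omega>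
        using that by (rule c'_const)
    qed blast
    then show ?case
      using orbit_closure_trans[OF subgroup_pointed_host_kra top[OF c_H] c' c''(1)] by blast
  qed
  from this[OF order_refl] obtain c' where c': "c' \<in> orbit_closure (cube n) (pointed_host_kra G n) c"
    "\<And>\<omega>. \<omega> \<in> cube n \<Longrightarrow> c' \<omega> = y" by auto
  have "c' = const_cube n y"
    using c'(2) top[OF c'(1)] by (auto simp: const_cube_def fun_eq_iff PiE_iff extensional_def)
  then show ?thesis using c'(1) by (simp add: y_def)
qed

section \<open>The relation \<open>NRP\<close> in terms of pointed orbit closures\<close>

text \<open>A cube reaches the constant with its value at \<open>ones n\<close> under
  \<open>F\<close>; for a corner this can be reversed by \<open>F\<close>-minimality. Conversely,
  \<open>F\<close> is contained in \<open>H\<close>.\<close>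

lemma corner_mem_dynamical_cubes_iff:
  assumes n: "n \<ge> 1" and x: "x \<in> topspace X" and y: "y \<in> topspace X"
  shows "corner n x y \<in> dynamical_cubes G X \<phi> n \<longleftrightarrow>
    corner n x y \<in> orbit_closure (cube n) (pointed_host_kra G n) (const_cube n y)"
proof
  assume "corner n x y \<in> dynamical_cubes G X \<phi> n"
  from const_mem_pointed_orbit_closure[OF n this]
  have "const_cube n y \<in> orbit_closure (cube n) (pointed_host_kra G n) (corner n x y)"
    using ones_in_cube[of n] by (simp add: corner_def)
  then show "corner n x y \<in> orbit_closure (cube n) (pointed_host_kra G n) (const_cube n y)"
    by (rule mem_orbit_closure_pointed_host_kra_sym[OF x y])
next
  assume "corner n x y \<in> orbit_closure (cube n) (pointed_host_kra G n) (const_cube n y)"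
  moreover have "pointed_host_kra G n \<subseteq> host_kra G n" by (auto simp: pointed_host_kra_def)
  ultimately show "corner n x y \<in> dynamical_cubes G X \<phi> n"
    using dynamical_cubes_eq[OF n y] orbit_closure_mono by blast
qed

text \<open>Overwriting the value at \<open>ones n\<close> is continuous and commutes with the
  action of \<open>F\<close>, which is trivial at that vertex.\<close>

lemma corner_orbit_closure_change_vertex:
  assumes x: "x \<in> topspace X" and "y \<in> topspace X" "z \<in> topspace X" "z' \<in> topspace X"
    and mem: "corner n y z \<in> orbit_closure (cube n) (pointed_host_kra G n) (corner n z' z)"
  shows "corner n y x \<in> orbit_closure (cube n) (pointed_host_kra G n) (corner n z' x)"
proof -
  let ?XI = "product_topology (\<lambda>_. X) (cube n)"
  let ?f = "\<lambda>c. \<lambda>\<omega>\<in>cube n. if \<omega> = ones n then x else c \<omega>"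
  let ?orb = "\<lambda>c. (\<lambda>\<gamma>. pointwise (cube n) (\<lambda>\<omega>. \<phi> (\<gamma> \<omega>)) c) ` pointed_host_kra G n"
  have f_corner: "?f (corner n y z) = corner n y x" for y z
    by (auto simp: corner_def)
  have "continuous_map ?XI ?XI ?f"
    unfolding continuous_map_componentwise
  proof (intro conjI ballI)
    fix \<omega> assume "\<omega> \<in> cube n"
    then show "continuous_map ?XI X (\<lambda>c. ?f c \<omega>)"
      using x by (cases "\<omega> = ones n") (auto intro: continuous_map_product_projection)
  qed auto
  from continuous_map_image_closure_subset[OF this, of "?orb (corner n z' z)"]
  have "?f (corner n y z) \<in> ?XI closure_of (?f ` ?orb (corner n z' z))"
    using mem unfolding orbit_closure_def by blast
  moreover have "?f ` ?orb (corner n z' z) = ?orb (corner n z' x)"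
    unfolding image_image
  proof (rule image_cong[OF refl])
    fix \<gamma> assume \<gamma>: "\<gamma> \<in> pointed_host_kra G n"
    show "?f (pointwise (cube n) (\<lambda>\<omega>. \<phi> (\<gamma> \<omega>)) (corner n z' z)) = pointwise (cube n) (\<lambda>\<omega>. \<phi> (\<gamma> \<omega>)) (corner n z' x)"
      using \<gamma> x by (auto simp: pointwise_def corner_def pointed_host_kra_def action_one)
  qed
  ultimately show ?thesis unfolding f_corner orbit_closure_def by simp
qed

text \<open>The constant is written as \<open>corner (d + 1) y y\<close> so that its value at
  \<open>ones (d + 1)\<close> can be overwritten separately.\<close>

lemma NRP_iff:
  "(x, y) \<in> NRP G X \<phi> d \<longleftrightarrow> x \<in> topspace X \<and> y \<in> topspace X \<and>
     corner (d + 1) x y \<in> orbit_closure (cube (d + 1)) (pointed_host_kra G (d + 1)) (corner (d + 1) y y)"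
  using corner_mem_dynamical_cubes_iff[of "d + 1"] by (auto simp: NRP_def corner_same)

lemma equiv_NRP: "equiv (topspace X) (NRP G X \<phi> d)"
proof -
  define n where "n = d + 1"
  define F where "F = pointed_host_kra G n"
  have sF: "subgroup F (product_group (cube n) (\<lambda>_. G))"
    unfolding F_def by (rule subgroup_pointed_host_kra)
  note change = corner_orbit_closure_change_vertex[where n = n, folded F_def]
  note sym = mem_orbit_closure_pointed_host_kra_sym[where n = n, folded F_def]
  show ?thesis
  proof (rule equivI)
    show "NRP G X \<phi> d \<subseteq> topspace X \<times> topspace X" by (auto simp: NRP_def)
    show "refl_on (topspace X) (NRP G X \<phi> d)"
    proof (rule refl_onI)
      fix x assume x: "x \<in> topspace X"
      have "const_cube (d + 1) x \<in> dynamical_cubes G X \<phi> (d + 1)"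
        using dynamical_cubes_eq[of "d + 1"] const_mem_orbit_closure[of "d + 1"] x by simp
      then show "(x, x) \<in> NRP G X \<phi> d" using x unfolding NRP_def corner_same[symmetric] by simp
    qed
    show "sym (NRP G X \<phi> d)"
    proof (rule symI)
      fix x y assume "(x, y) \<in> NRP G X \<phi> d"
      then have tops: "x \<in> topspace X" "y \<in> topspace X"
        and "corner n x y \<in> orbit_closure (cube n) F (corner n y y)"
        by (auto simp: NRP_iff F_def n_def)
      \<comment> \<open>Reverse the membership by \<open>F\<close>-minimality of the corner, then
        overwrite \<open>y\<close> by \<open>x\<close> at \<open>ones n\<close>.\<close>
      then have "corner n y y \<in> orbit_closure (cube n) F (corner n x y)"
        using sym by blast
      then have "corner n y x \<in> orbit_closure (cube n) F (corner n x x)"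
        using change tops by blast
      then show "(y, x) \<in> NRP G X \<phi> d"
        using tops by (simp add: NRP_iff F_def n_def)
    qed
    show "trans (NRP G X \<phi> d)"
    proof (rule transI)
      fix x y z assume xy: "(x, y) \<in> NRP G X \<phi> d" and yz: "(y, z) \<in> NRP G X \<phi> d"
      have tops: "x \<in> topspace X" "y \<in> topspace X" "z \<in> topspace X" using xy yz by (auto simp: NRP_def)
      \<comment> \<open>Both \<open>corner n x y\<close> and \<open>corner n z y\<close> are reached
        from the constant \<open>y\<close>. Minimality of the latter gives a path from it through
        the constant to the former; overwriting \<open>y\<close> by \<open>z\<close> at
        \<open>ones n\<close> turns the starting corner into the constant \<open>z\<close>.\<close>
      have "corner n z y \<in> orbit_closure (cube n) F (corner n y y)"
        using yz \<open>sym (NRP G X \<phi> d)\<close> by (auto simp: NRP_iff F_def n_def dest: symD)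
      then have "corner n y y \<in> orbit_closure (cube n) F (corner n z y)"
        using sym tops by blast
      moreover have "corner n x y \<in> orbit_closure (cube n) F (corner n y y)"
        using xy by (simp add: NRP_iff F_def n_def)
      ultimately have "corner n x y \<in> orbit_closure (cube n) F (corner n z y)"
        using orbit_closure_trans[OF sF corner_in_topspace] tops by blast
      then have "corner n x z \<in> orbit_closure (cube n) F (corner n z z)"
        by (rule change[OF tops(3,1,2,3)])
      then show "(x, z) \<in> NRP G X \<phi> d"
        using tops by (simp add: NRP_iff F_def n_def)
    qed
  qed
qed

lemma closedin_NRP: "closedin (prod_topology X X) (NRP G X \<phi> d)"
proof -
  let ?XI = "product_topology (\<lambda>_. X) (cube (d + 1))"
  let ?f = "\<lambda>p. corner (d + 1) (fst p) (snd p)"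
  have "continuous_map (prod_topology X X) ?XI ?f"
    unfolding continuous_map_componentwise
  proof (intro conjI ballI)
    fix \<omega> assume "\<omega> \<in> cube (d + 1)"
    then show "continuous_map (prod_topology X X) X (\<lambda>p. ?f p \<omega>)"
      by (cases "\<omega> = ones (d + 1)") (auto simp: corner_def continuous_map_fst continuous_map_snd)
  qed (auto simp: corner_def)
  moreover have "closedin ?XI (dynamical_cubes G X \<phi> (d + 1))" by (simp add: dynamical_cubes_def)
  ultimately have "closedin (prod_topology X X)
      {p \<in> topspace (prod_topology X X). ?f p \<in> dynamical_cubes G X \<phi> (d + 1)}"
    by (rule closedin_continuous_map_preimage)
  also have "{p \<in> topspace (prod_topology X X). ?f p \<in> dynamical_cubes G X \<phi> (d + 1)} = NRP G X \<phi> d"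
    by (auto simp: NRP_def)
  finally show ?thesis .
qed

text \<open>The diagonal element of \<open>g\<close> lies in the cube group, whose action preserves
  the set of cubes and sends corners to corners.\<close>

lemma NRP_invariant:
  assumes g: "g \<in> carrier G" and xy: "(x, y) \<in> NRP G X \<phi> d"
  shows "(\<phi> g x, \<phi> g y) \<in> NRP G X \<phi> d"
proof -
  have x: "x \<in> topspace X" and y: "y \<in> topspace X" using xy by (auto simp: NRP_def)
  define n where "n = d + 1"
  have n: "n \<ge> 1" by (simp add: n_def)
  have "corner n x y \<in> orbit_closure (cube n) (host_kra G n) (const_cube n x)"
    using xy dynamical_cubes_eq[OF n x] by (simp add: NRP_def n_def)
  moreover have "pointwise (cube n) (\<lambda>\<omega>. \<phi> ((\<lambda>\<omega>\<in>cube n. g) \<omega>)) (corner n x y)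
      \<in> orbit_closure (cube n) (host_kra G n) (corner n x y)"
    by (rule action_mem_orbit_closure[OF subgroup_host_kra host_kra_const[OF n g] corner_in_topspace[OF x y]])
  moreover have "pointwise (cube n) (\<lambda>\<omega>. \<phi> ((\<lambda>\<omega>\<in>cube n. g) \<omega>)) (corner n x y) = corner n (\<phi> g x) (\<phi> g y)"
    by (auto simp: pointwise_def corner_def)
  ultimately have "corner n (\<phi> g x) (\<phi> g y) \<in> orbit_closure (cube n) (host_kra G n) (const_cube n x)"
    using orbit_closure_trans[OF subgroup_host_kra const_cube_in_topspace[OF x]] by (simp only:)
  then show ?thesis
    using action_in_topspace[OF g] x y dynamical_cubes_eq[OF n x] by (simp add: NRP_def n_def)
qed

end

theorem theorem3p8:
  fixes G :: "('a, 'm) monoid_scheme" and T :: "'a topology"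
    and X :: "'b topology" and \<phi> :: "'a \<Rightarrow> 'b \<Rightarrow> 'b" and d :: nat
  assumes "minimal_system G T X \<phi>"
    and "d \<ge> 1"
  shows "closedin (prod_topology X X) (NRP G X \<phi> d)
    \<and> (\<forall>g\<in>carrier G. \<forall>(x, y)\<in>NRP G X \<phi> d. (\<phi> g x, \<phi> g y) \<in> NRP G X \<phi> d)
    \<and> equiv (topspace X) (NRP G X \<phi> d)"
proof -
  interpret minimal_system G T X \<phi> by fact
  show ?thesis using closedin_NRP NRP_invariant equiv_NRP by blast
qed

end
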